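(* Let $(\mathbb{H}, g_{\mathbb{H}})$ be hyperbolic space of dimension $m \geq 3$ and let $0 < T \leq \infty$. Let $(g(t))_{t\in[0,T[}$ be a Yamabe flow on $\mathbb{H}$ with $g(0) = g_{\mathbb{H}}$. Then the flow is uniquely given by $g(t) = (m(m-1)t + 1)\, g_{\mathbb{H}}$ for all $t \in [0,T[$.
   Context: Hyperbolic space $(\mathbb{H}, g_{\mathbb{H}})$ is the complete, simply connected, noncompact Riemannian manifold of constant sectional curvature $-1$; its scalar curvature is $-m(m-1)$. A family $(g(t))_{t\in[0,T[}$ of Riemannian metrics on a manifold $M$ is a Yamabe flow with initial metric $g_0$ if $\frac{\partial}{\partial t} g(t) = -\mathrm{R}_{g(t)}\, g(t)$ for all $t \in [0,T[$ and $g(0) = g_0$, where $\mathrm{R}_g$ denotes the scalar curvature of $(M,g)$. The flow preserves the conformal class: if $g_0 = u_0 g_{\mathbb{H}}$, then $g(t) = u(\cdot,t) g_{\mathbb{H}}$ with a positive function $u$ on $\mathbb{H}\times[0,T[$, and the flow equation is equivalent to $$\frac{1}{m-1}\frac{\partial u}{\partial t} = m + \frac{\Delta_{g_{\mathbb{H}}} u}{u} + \frac{m-6}{4}\,\frac{|\nabla u|^2_{g_{\mathbb{H}}}}{u^2}, \qquad u(\cdot,0)=u_0.$$ Regularity is understood as $u \in \mathrm{C}^{2;1}(\mathbb{H}\times[0,T[)$: $u$, its spatial derivatives up to order two and $\frac{\partial u}{\partial t}$ are continuous on $\mathbb{H}\times[0,T[$. No completeness, boundedness or symmetry of $g(t)$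 for $t>0$ is assumed. *)

theory Defs
  imports "HOL-Analysis.Analysis"
begin

text \<open>
  Manifolds covered by one global chart: open subsets of \<open>real ^ 'm\<close>, of dimension \<open>CARD('m)\<close>.
  A tensor field is given by its components in the standard coordinates; in particular
  a Riemannian metric is a matrix-valued function \<open>g\<close>, with \<open>g x $ i $ j = g(\<partial>\<^sub>i, \<partial>\<^sub>j)\<close> at \<open>x\<close>.
\<close>

definition partial_differentiable ::
    "'m::finite \<Rightarrow> (real ^ 'm \<Rightarrow> real) \<Rightarrow> real ^ 'm \<Rightarrow> bool" where
  "partial_differentiable i f x \<longleftrightarrow>
     (\<lambda>s. f (x + s *\<^sub>R axis i 1)) field_differentiable (at 0)"

definition partial_deriv ::
    "'m::finite \<Rightarrow> (real ^ 'm \<Rightarrow> real) \<Rightarrow> real ^ 'm \<Rightarrow> real" where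
  "partial_deriv i f x = deriv (\<lambda>s. f (x + s *\<^sub>R axis i 1)) 0"

definition riemannian_metric_on ::
    "(real ^ 'm) set \<Rightarrow> (real ^ 'm::finite \<Rightarrow> real ^ 'm ^ 'm) \<Rightarrow> bool" where
  "riemannian_metric_on M g \<longleftrightarrow>
     (\<forall>x\<in>M. transpose (g x) = g x \<and> (\<forall>v. v \<noteq> 0 \<longrightarrow> 0 < v \<bullet> (g x *v v)))"

text \<open>Christoffel symbols of the Levi-Civita connection: \<open>christoffel g k i j\<close> is \<open>\<Gamma>\<^sup>k\<^sub>i\<^sub>j\<close>.\<close>

definition christoffel ::
    "(real ^ 'm::finite \<Rightarrow> real ^ 'm ^ 'm) \<Rightarrow> 'm \<Rightarrow> 'm \<Rightarrow> 'm \<Rightarrow> real ^ 'm \<Rightarrow> real" where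
  "christoffel g k i j x =
     (\<Sum>l\<in>UNIV. matrix_inv (g x) $ k $ l *
        (partial_deriv i (\<lambda>y. g y $ j $ l) x + partial_deriv j (\<lambda>y. g y $ i $ l) x
          - partial_deriv l (\<lambda>y. g y $ i $ j) x)) / 2"

text \<open>
  \<open>riemann g l k i j\<close> is the \<open>l\<close>-th component of \<open>R(\<partial>\<^sub>i, \<partial>\<^sub>j) \<partial>\<^sub>k\<close>, where
  \<open>R(X, Y) = \<nabla>\<^sub>X \<nabla>\<^sub>Y - \<nabla>\<^sub>Y \<nabla>\<^sub>X - \<nabla>\<^bsub>[X, Y]\<^esub>\<close>. With this convention \<open>Ric(Y, Z)\<close> is the trace of
  \<open>X \<mapsto> R(X, Y) Z\<close>, and round spheres have positive curvature.
\<close>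

definition riemann ::
    "(real ^ 'm::finite \<Rightarrow> real ^ 'm ^ 'm) \<Rightarrow> 'm \<Rightarrow> 'm \<Rightarrow> 'm \<Rightarrow> 'm \<Rightarrow> real ^ 'm \<Rightarrow> real" where
  "riemann g l k i j x =
     partial_deriv i (christoffel g l j k) x - partial_deriv j (christoffel g l i k) x
     + (\<Sum>p\<in>UNIV. christoffel g l i p x * christoffel g p j k x
                 - christoffel g l j p x * christoffel g p i k x)"

definition ricci ::
    "(real ^ 'm::finite \<Rightarrow> real ^ 'm ^ 'm) \<Rightarrow> 'm \<Rightarrow> 'm \<Rightarrow> real ^ 'm \<Rightarrow> real" where
  "ricci g j k x = (\<Sum>i\<in>UNIV. riemann g i k i j x)"

definition scalar_curvature ::
    "(real ^ 'm::finite \<Rightarrow> real ^ 'm ^ 'm) \<Rightarrow> real ^ 'm \<Rightarrow> real" where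
  "scalar_curvature g x = (\<Sum>j\<in>UNIV. \<Sum>k\<in>UNIV. matrix_inv (g x) $ j $ k * ricci g j k x)"

text \<open>
  \<open>sectional_curvature g v w x\<close> is \<open>g(R(v, w) w, v) / (g(v, v) g(w, w) - g(v, w)\<^sup>2)\<close> at \<open>x\<close>.
\<close>

definition sectional_curvature ::
    "(real ^ 'm::finite \<Rightarrow> real ^ 'm ^ 'm) \<Rightarrow> real ^ 'm \<Rightarrow> real ^ 'm \<Rightarrow> real ^ 'm \<Rightarrow> real" where
  "sectional_curvature g v w x =
     (let Rvww = (\<chi> l. \<Sum>i\<in>UNIV. \<Sum>j\<in>UNIV. \<Sum>k\<in>UNIV. riemann g l k i j x * v $ i * w $ j * w $ k)
      in (v \<bullet> (g x *v Rvww)) /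
         ((v \<bullet> (g x *v v)) * (w \<bullet> (g x *v w)) - (v \<bullet> (g x *v w))\<^sup>2))"

text \<open>Hyperbolic space: the Poincare ball model.\<close>

abbreviation hyperbolic_space :: "(real ^ 'm::finite) set" where
  "hyperbolic_space \<equiv> ball 0 1"

definition hyperbolic_metric :: "real ^ 'm::finite \<Rightarrow> real ^ 'm ^ 'm" where
  "hyperbolic_metric x = (4 / (1 - (norm x)\<^sup>2)\<^sup>2) *\<^sub>R mat 1"

definition time_interval :: "ereal \<Rightarrow> real set" where
  "time_interval T = {t. 0 \<le> t \<and> ereal t < T}"

text \<open>
  The class \<open>C\<^sup>2\<^sup>;\<^sup>1(M \<times> I)\<close>, for functions of time (first argument) and space. The time
  derivative is one-sided at an endpoint of \<open>I\<close>.
\<close>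

definition C21_on ::
    "(real ^ 'm::finite) set \<Rightarrow> real set \<Rightarrow> (real \<Rightarrow> real ^ 'm \<Rightarrow> real) \<Rightarrow> bool" where
  "C21_on M I f \<longleftrightarrow>
     continuous_on (I \<times> M) (\<lambda>(t, x). f t x) \<and>
     (\<forall>i. (\<forall>t\<in>I. \<forall>x\<in>M. partial_differentiable i (f t) x) \<and>
          continuous_on (I \<times> M) (\<lambda>(t, x). partial_deriv i (f t) x)) \<and>
     (\<forall>i j. (\<forall>t\<in>I. \<forall>x\<in>M. partial_differentiable j (partial_deriv i (f t)) x) \<and>
          continuous_on (I \<times> M) (\<lambda>(t, x). partial_deriv j (partial_deriv i (f t)) x)) \<and>
     (\<exists>f'. (\<forall>t\<in>I. \<forall>x\<in>M. ((\<lambda>s. f s x) has_real_derivative f' t x) (at t within I)) \<and>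
          continuous_on (I \<times> M) (\<lambda>(t, x). f' t x))"

definition yamabe_flow_on ::
    "(real ^ 'm::finite) set \<Rightarrow> ereal \<Rightarrow> (real \<Rightarrow> real ^ 'm \<Rightarrow> real ^ 'm ^ 'm) \<Rightarrow> bool" where
  "yamabe_flow_on M T g \<longleftrightarrow>
     (\<forall>t\<in>time_interval T. riemannian_metric_on M (g t)) \<and>
     (\<forall>i j. C21_on M (time_interval T) (\<lambda>t x. g t x $ i $ j)) \<and>
     (\<forall>t\<in>time_interval T. \<forall>x\<in>M.
        ((\<lambda>s. g s x) has_vector_derivative - scalar_curvature (g t) x *\<^sub>R g t x)
          (at t within time_interval T))"

text \<open>
  The remaining lemmas are a check of the conventions. The ball model has constant sectional
  curvature \<open>-1\<close> and scalar curvature \<open>- m (m - 1)\<close>, where \<open>m = CARD('m)\<close>, and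
  \<open>(m (m - 1) t + 1) g\<close> is a Yamabe flow starting at the hyperbolic metric \<open>g\<close>.
\<close>

lemma partial_deriv_eqI:
  "((\<lambda>s. f (x + s *\<^sub>R axis i 1)) has_real_derivative D) (at 0) \<Longrightarrow> partial_deriv i f x = D"
  by (simp add: partial_deriv_def DERIV_imp_deriv)

lemma eventually_in_open:
  fixes x :: "real ^ 'm::finite"
  assumes "open M" "x \<in> M"
  shows "eventually (\<lambda>s. x + s *\<^sub>R axis i 1 \<in> M) (nhds (0::real))"
proof -
  have "continuous_on UNIV (\<lambda>s. x + s *\<^sub>R axis i (1::real))"
    by (intro continuous_intros)
  then have "open ((\<lambda>s. x + s *\<^sub>R axis i (1::real)) -` M)"
    using assms(1) by (rule open_vimage[rotated])
  then show ?thesis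
    using assms(2) by (auto simp: eventually_nhds)
qed

lemma partial_deriv_cong:
  assumes "open M" "x \<in> M" "\<And>y. y \<in> M \<Longrightarrow> f y = h y"
  shows "partial_deriv i f x = partial_deriv i h x"
  unfolding partial_deriv_def
  by (rule deriv_cong_ev[OF eventually_mono[OF eventually_in_open[OF assms(1,2)]] refl])
     (rule assms(3))

lemma matrix_inv_scaleR_mat:
  assumes "c \<noteq> 0"
  shows "matrix_inv (c *\<^sub>R mat 1 :: real ^ 'm ^ 'm::finite) = (1 / c) *\<^sub>R mat 1"
proof -
  let ?A = "c *\<^sub>R mat 1 :: real ^ 'm ^ 'm" and ?B = "(1 / c) *\<^sub>R mat 1 :: real ^ 'm ^ 'm"
  have AB: "?A ** ?B = mat 1" "?B ** ?A = mat 1"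
    using assms by (simp_all add: matrix_scalar_ac flip: scalar_matrix_assoc)
  then have "?A ** matrix_inv ?A = mat 1 \<and> matrix_inv ?A ** ?A = mat 1"
    unfolding matrix_inv_def by (rule_tac someI[of _ ?B]) blast
  then show ?thesis
    by (metis AB(2) matrix_mul_assoc matrix_mul_lid matrix_mul_rid)
qed

definition kron :: "'a \<Rightarrow> 'a \<Rightarrow> real" where
  "kron i j = (if i = j then 1 else 0)"

lemma kron_commute: "kron i j = kron j i"
  by (simp add: kron_def)

lemma kron_same [simp]: "kron i i = 1"
  by (simp add: kron_def)

lemma sum_kron [simp]:
  "(\<Sum>p\<in>UNIV. kron (a::'m::finite) p * f p) = f a"
  "(\<Sum>p\<in>UNIV. kron p (a::'m::finite) * f p) = f a"
  "(\<Sum>p\<in>UNIV. f p * kron (a::'m::finite) p) = f a"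
  "(\<Sum>p\<in>UNIV. f p * kron p (a::'m::finite)) = f a"
  by (simp_all add: kron_def if_distrib[of "\<lambda>a. a * _"] if_distrib[of "\<lambda>a. _ * a"] cong: if_cong)

lemma conformal_component: "(c *\<^sub>R mat 1 :: real ^ 'm ^ 'm::finite) $ i $ j = c * kron i j"
  by (simp add: mat_def kron_def)

lemma ball_D: "(x :: real ^ 'm::finite) \<in> ball 0 1 \<Longrightarrow> 1 - x \<bullet> x > 0"
  by (simp add: dot_square_norm power_less_one_iff abs_square_less_1 flip: power2_norm_eq_inner)

lemma inner_line:
  "((x :: real ^ 'm::finite) + s *\<^sub>R axis i 1) \<bullet> (x + s *\<^sub>R axis i 1) = x \<bullet> x + 2 * s * x $ i + s * s"
  by (simp add: inner_add_left inner_add_right inner_axis inner_axis' algebra_simps inner_commute)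

lemma comp_line: "((x :: real ^ 'm::finite) + s *\<^sub>R axis i 1) $ j = x $ j + s * kron i j"
  by (auto simp: axis_def kron_def)

lemma DERIV_denominator:
  "((\<lambda>s. 1 - (x \<bullet> x + 2 * s * x $ i + s * s)) has_real_derivative - 2 * (x $ i)) (at 0)"
  for x :: "real ^ 'm::finite"
  by (auto intro!: derivative_eq_intros)

lemma DERIV_factor:
  assumes "(x :: real ^ 'm::finite) \<in> ball 0 1"
  shows "((\<lambda>s. 4 * c / (1 - (x + s *\<^sub>R axis i 1) \<bullet> (x + s *\<^sub>R axis i 1))\<^sup>2)
     has_real_derivative 16 * c * x $ i / (1 - x \<bullet> x)^3) (at 0)"
proof -
  define r where "r = 1 - x \<bullet> x"
  have r: "r > 0" using ball_D[OF assms] by (simp add: r_def)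
  have "((\<lambda>s. 4 * c / (1 - (x \<bullet> x + 2 * s * x $ i + s * s))\<^sup>2) has_real_derivative
     - (4 * c * (2 * r * (- 2 * (x $ i)))) / (r\<^sup>2 * r\<^sup>2)) (at 0)"
    using r by (auto intro!: derivative_eq_intros DERIV_denominator simp: r_def)
  moreover have "- (4 * c * (2 * r * (- 2 * (x $ i)))) / (r\<^sup>2 * r\<^sup>2) = 16 * c * x $ i / r^3"
    using r by (simp add: field_simps power2_eq_square power3_eq_cube)
  ultimately show ?thesis
    by (simp add: inner_line r_def)
qed

lemma hyperbolic_metric_alt:
  "c *\<^sub>R hyperbolic_metric x = (4 * c / (1 - x \<bullet> x)\<^sup>2) *\<^sub>R mat 1"
  by (simp add: hyperbolic_metric_def power2_norm_eq_inner)

lemma partial_deriv_hyperbolic: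
  assumes "(x :: real ^ 'm::finite) \<in> ball 0 1"
  shows "partial_deriv i (\<lambda>y. (c *\<^sub>R hyperbolic_metric y) $ j $ l) x =
     16 * c * x $ i / (1 - x \<bullet> x)^3 * kron j l"
  by (rule partial_deriv_eqI, unfold hyperbolic_metric_alt conformal_component)
     (rule DERIV_cmult_right[OF DERIV_factor[OF assms]])

lemma matrix_inv_hyperbolic:
  assumes "(x :: real ^ 'm::finite) \<in> ball 0 1" and "c \<noteq> 0"
  shows "matrix_inv (c *\<^sub>R hyperbolic_metric x) $ k $ l = (1 - x \<bullet> x)\<^sup>2 / (4 * c) * kron k l"
  using ball_D[OF assms(1)] assms(2)
  by (simp add: hyperbolic_metric_alt matrix_inv_scaleR_mat conformal_component
      del: vector_scaleR_component scaleR_scaleR)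

lemma christoffel_hyperbolic:
  assumes x: "(x :: real ^ 'm::finite) \<in> ball 0 1" and c: "c \<noteq> 0"
  shows "christoffel (\<lambda>y. c *\<^sub>R hyperbolic_metric y) k i j x =
     2 * (kron j k * x $ i + kron i k * x $ j - kron i j * x $ k) / (1 - x \<bullet> x)"
proof -
  define r where "r = 1 - x \<bullet> x"
  have r: "r \<noteq> 0" using ball_D[OF x] by (simp add: r_def)
  have "christoffel (\<lambda>y. c *\<^sub>R hyperbolic_metric y) k i j x =
     (\<Sum>l\<in>UNIV. kron k l * (r\<^sup>2 / (4 * c) * (16 * c * x $ i / r^3 * kron j l
      + 16 * c * x $ j / r^3 * kron i l - 16 * c * x $ l / r^3 * kron i j))) / 2"
    unfolding christoffel_def matrix_inv_hyperbolic[OF x c] partial_deriv_hyperbolic[OF x]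
    by (simp only: r_def mult_ac)
  also have "\<dots> = r\<^sup>2 / (4 * c) * (16 * c * x $ i / r^3 * kron j k
      + 16 * c * x $ j / r^3 * kron i k - 16 * c * x $ k / r^3 * kron i j) / 2"
    by (simp only: sum_kron)
  also have "\<dots> = 2 * (kron j k * x $ i + kron i k * x $ j - kron i j * x $ k) / r"
    using r c by (simp add: field_simps power2_eq_square power3_eq_cube)
  finally show ?thesis by (simp add: r_def)
qed

lemma partial_deriv_christoffel_hyperbolic:
  assumes x: "(x :: real ^ 'm::finite) \<in> ball 0 1" and c: "c \<noteq> 0"
  shows "partial_deriv l (christoffel (\<lambda>y. c *\<^sub>R hyperbolic_metric y) k i j) x =
     2 * (kron j k * kron l i + kron i k * kron l j - kron i j * kron l k) / (1 - x \<bullet> x)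
     + 4 * x $ l * (kron j k * x $ i + kron i k * x $ j - kron i j * x $ k) / (1 - x \<bullet> x)\<^sup>2"
proof -
  define r where "r = 1 - x \<bullet> x"
  have r: "r \<noteq> 0" using ball_D[OF x] by (simp add: r_def)
  let ?D = "2 * (kron j k * kron l i + kron i k * kron l j - kron i j * kron l k)"
  let ?E = "kron j k * x $ i + kron i k * x $ j - kron i j * x $ k"
  have "partial_deriv l (christoffel (\<lambda>y. c *\<^sub>R hyperbolic_metric y) k i j) x =
    partial_deriv l (\<lambda>x. 2 * (kron j k * x $ i + kron i k * x $ j - kron i j * x $ k) / (1 - x \<bullet> x)) x"
    by (rule partial_deriv_cong[OF open_ball x]) (rule christoffel_hyperbolic[OF _ c])
  also have "\<dots> = (?D * r - 2 * ?E * (- 2 * (x $ l))) / (r * r)"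
  proof (rule partial_deriv_eqI, unfold inner_line comp_line)
    let ?N = "\<lambda>s. 2 * (kron j k * (x $ i + s * kron l i) + kron i k * (x $ j + s * kron l j)
        - kron i j * (x $ k + s * kron l k))"
    have N: "(?N has_real_derivative ?D) (at 0)"
      by (auto intro!: derivative_eq_intros)
    show "((\<lambda>s. ?N s / (1 - (x \<bullet> x + 2 * s * x $ l + s * s))) has_real_derivative
       (?D * r - 2 * ?E * (- 2 * (x $ l))) / (r * r)) (at 0)"
      using DERIV_divide[OF N DERIV_denominator[of x l]] r by (simp add: r_def)
  qed
  also have "\<dots> = ?D / r + 4 * x $ l * ?E / r\<^sup>2"
  proof -
    have "(A * r - 2 * B * (- 2 * C)) / (r * r) = A / r + 4 * C * B / r\<^sup>2" for A B C
      using r by (simp add: field_simps power2_eq_square)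
    then show ?thesis .
  qed
  finally show ?thesis by (simp add: r_def)
qed

lemma riemann_hyperbolic:
  assumes x: "(x :: real ^ 'm::finite) \<in> ball 0 1" and c: "c \<noteq> 0"
  shows "riemann (\<lambda>y. c *\<^sub>R hyperbolic_metric y) l k i j x =
    4 / (1 - x \<bullet> x)\<^sup>2 * (kron j l * kron i k - kron i l * kron j k)"
proof -
  define \<rho> where "\<rho> = 1 / (1 - x \<bullet> x)"
  have \<rho>: "\<rho> * (1 - x \<bullet> x) = 1" using ball_D[OF x] by (simp add: \<rho>_def)
  have xx: "(\<Sum>p\<in>UNIV. x $ p * x $ p) = x \<bullet> x" by (simp add: inner_vec_def)
  have G: "christoffel (\<lambda>y. c *\<^sub>R hyperbolic_metric y) k i j x =
     2 * \<rho> * (kron j k * x $ i + kron i k * x $ j - kron i j * x $ k)" for k i j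
    by (simp add: christoffel_hyperbolic[OF x c] \<rho>_def)
  have S: "(\<Sum>p\<in>UNIV. (2 * \<rho> * (kron p l * x $ i + kron i l * x $ p - kron i p * x $ l)) *
        (2 * \<rho> * (kron k p * x $ j + kron j p * x $ k - kron j k * x $ p))) =
     4 * \<rho>\<^sup>2 * (x $ i * (kron k l * x $ j + kron j l * x $ k - kron j k * x $ l)
       + kron i l * (2 * (x $ j * x $ k) - kron j k * (x \<bullet> x))
       - x $ l * (kron k i * x $ j + kron j i * x $ k - kron j k * x $ i))" (is "?L = ?R") for i j
  proof -
    have "?L = 4 * \<rho>\<^sup>2 * (\<Sum>p\<in>UNIV. kron p l * (x $ i * (kron k p * x $ j + kron j p * x $ k - kron j k * x $ p))
       + kron i l * (kron k p * (x $ p * x $ j) + kron j p * (x $ p * x $ k) - kron j k * (x $ p * x $ p))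
       - kron i p * (x $ l * (kron k p * x $ j + kron j p * x $ k - kron j k * x $ p)))"
      unfolding sum_distrib_left by (rule sum.cong) (simp_all add: algebra_simps power2_eq_square)
    also have "\<dots> = ?R"
      unfolding sum.distrib sum_subtractf sum_kron
      by (simp only: sum_distrib_left[symmetric] sum.distrib sum_subtractf sum_kron xx)
         (simp add: algebra_simps)
    finally show ?thesis .
  qed
  have "riemann (\<lambda>y. c *\<^sub>R hyperbolic_metric y) l k i j x =
     (2 * \<rho> * (kron k l * kron i j + kron j l * kron i k - kron j k * kron i l)
     + 4 * \<rho>\<^sup>2 * x $ i * (kron k l * x $ j + kron j l * x $ k - kron j k * x $ l))
     - (2 * \<rho> * (kron k l * kron j i + kron i l * kron j k - kron i k * kron j l)
     + 4 * \<rho>\<^sup>2 * x $ j * (kron k l * x $ i + kron i l * x $ k - kron i k * x $ l))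
     + (4 * \<rho>\<^sup>2 * (x $ i * (kron k l * x $ j + kron j l * x $ k - kron j k * x $ l)
       + kron i l * (2 * (x $ j * x $ k) - kron j k * (x \<bullet> x))
       - x $ l * (kron k i * x $ j + kron j i * x $ k - kron j k * x $ i))
       - 4 * \<rho>\<^sup>2 * (x $ j * (kron k l * x $ i + kron i l * x $ k - kron i k * x $ l)
       + kron j l * (2 * (x $ i * x $ k) - kron i k * (x \<bullet> x))
       - x $ l * (kron k j * x $ i + kron i j * x $ k - kron i k * x $ j)))"
    unfolding riemann_def partial_deriv_christoffel_hyperbolic[OF x c] G sum_subtractf S
    by (simp add: \<rho>_def power_divide)
  also have "\<dots> = 4 * \<rho>\<^sup>2 * (kron j l * kron i k - kron i l * kron j k)"
    unfolding kron_commute[of k i] kron_commute[of k j] kron_commute[of j i]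
    using \<rho> by algebra
  finally show ?thesis by (simp add: \<rho>_def power_divide)
qed

lemma scalar_curvature_hyperbolic:
  assumes x: "(x :: real ^ 'm::finite) \<in> ball 0 1" and c: "c \<noteq> 0"
  shows "scalar_curvature (\<lambda>y. c *\<^sub>R hyperbolic_metric y) x =
    - (real CARD('m) * (real CARD('m) - 1) / c)"
proof -
  define r where "r = 1 - x \<bullet> x"
  have r: "r \<noteq> 0" using ball_D[OF x] by (simp add: r_def)
  have Ric: "ricci (\<lambda>y. c *\<^sub>R hyperbolic_metric y) j k x = 4 / r\<^sup>2 * ((1 - real CARD('m)) * kron j k)" for j k
    unfolding ricci_def riemann_hyperbolic[OF x c] r_def[symmetric]
    by (simp only: sum_distrib_left[symmetric] sum_subtractf sum_kron kron_same)
       (simp add: left_diff_distrib)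
  have "scalar_curvature (\<lambda>y. c *\<^sub>R hyperbolic_metric y) x =
     (\<Sum>j\<in>(UNIV::'m set). r\<^sup>2 / (4 * c) * (4 / r\<^sup>2 * (1 - real CARD('m))))"
    unfolding scalar_curvature_def Ric matrix_inv_hyperbolic[OF x c] r_def[symmetric]
  proof (rule sum.cong[OF refl])
    fix j :: 'm
    have "(\<Sum>k\<in>UNIV. r\<^sup>2 / (4 * c) * kron j k * (4 / r\<^sup>2 * ((1 - real CARD('m)) * kron j k))) =
      (\<Sum>k\<in>UNIV. kron j k * (r\<^sup>2 / (4 * c) * (4 / r\<^sup>2 * ((1 - real CARD('m)) * kron j k))))"
      by (simp only: mult_ac)
    then show "(\<Sum>k\<in>UNIV. r\<^sup>2 / (4 * c) * kron j k * (4 / r\<^sup>2 * ((1 - real CARD('m)) * kron j k))) =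
      r\<^sup>2 / (4 * c) * (4 / r\<^sup>2 * (1 - real CARD('m)))"
      by (simp only: sum_kron kron_same mult_1_right)
  qed
  also have "\<dots> = - (real CARD('m) * (real CARD('m) - 1) / c)"
    using r c by (simp add: field_simps)
  finally show ?thesis .
qed

lemma sectional_curvature_hyperbolic:
  assumes x: "(x :: real ^ 'm::finite) \<in> ball 0 1"
    and indep: "(v \<bullet> v) * (w \<bullet> w) \<noteq> (v \<bullet> w)\<^sup>2"
  shows "sectional_curvature hyperbolic_metric v w x = -1"
proof -
  define q where "q = 4 / (1 - x \<bullet> x)\<^sup>2"
  have q: "q \<noteq> 0" using ball_D[OF x] by (simp add: q_def)
  have R: "riemann hyperbolic_metric l k i j x = q * (kron j l * kron i k - kron i l * kron j k)" for l k i j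
    using riemann_hyperbolic[OF x, of 1 l k i j] by (simp add: q_def)
  have g: "hyperbolic_metric x *v u = q *\<^sub>R u" for u
    by (simp add: hyperbolic_metric_def q_def power2_norm_eq_inner flip: scaleR_matrix_vector_assoc)
  have S: "(\<Sum>i\<in>UNIV. \<Sum>j\<in>UNIV. \<Sum>k\<in>UNIV. riemann hyperbolic_metric l k i j x * v $ i * w $ j * w $ k)
     = q * ((v \<bullet> w) * w $ l - (w \<bullet> w) * v $ l)" for l
  proof -
    have "(\<Sum>k\<in>UNIV. riemann hyperbolic_metric l k i j x * v $ i * w $ j * w $ k)
       = kron j l * (q * v $ i * w $ j * w $ i) - kron i l * (q * v $ i * w $ j * w $ j)" for i j
    proof -
      have "(\<Sum>k\<in>UNIV. riemann hyperbolic_metric l k i j x * v $ i * w $ j * w $ k)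
       = (\<Sum>k\<in>UNIV. kron i k * (kron j l * (q * v $ i * w $ j * w $ k))
          - kron j k * (kron i l * (q * v $ i * w $ j * w $ k)))"
        by (rule sum.cong) (simp_all add: R algebra_simps)
      then show ?thesis by (simp only: sum_subtractf sum_kron)
    qed
    then have "(\<Sum>i\<in>UNIV. \<Sum>j\<in>UNIV. \<Sum>k\<in>UNIV. riemann hyperbolic_metric l k i j x * v $ i * w $ j * w $ k)
      = (\<Sum>i\<in>UNIV. q * v $ i * w $ l * w $ i) - (\<Sum>i\<in>UNIV. kron i l * (\<Sum>j\<in>UNIV. q * v $ i * w $ j * w $ j))"
      by (simp only: sum_subtractf sum_kron sum_distrib_left)
    also have "\<dots> = q * ((v \<bullet> w) * w $ l - (w \<bullet> w) * v $ l)"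
      unfolding sum_kron by (simp add: inner_vec_def sum_distrib_left sum_distrib_right mult_ac right_diff_distrib)
    finally show ?thesis .
  qed
  have Rv: "(\<chi> l. q * ((v \<bullet> w) * w $ l - (w \<bullet> w) * v $ l)) = q *\<^sub>R ((v \<bullet> w) *\<^sub>R w - (w \<bullet> w) *\<^sub>R v)"
    by (simp add: vec_eq_iff)
  have "sectional_curvature hyperbolic_metric v w x =
     (q\<^sup>2 * ((v \<bullet> w)\<^sup>2 - (v \<bullet> v) * (w \<bullet> w))) / (q\<^sup>2 * ((v \<bullet> v) * (w \<bullet> w) - (v \<bullet> w)\<^sup>2))"
    unfolding sectional_curvature_def S Rv Let_def g
    by (simp add: inner_diff_right algebra_simps power2_eq_square)
  also have "\<dots> = ((v \<bullet> w)\<^sup>2 - (v \<bullet> v) * (w \<bullet> w)) / ((v \<bullet> v) * (w \<bullet> w) - (v \<bullet> w)\<^sup>2)"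
    using q by simp
  also have "\<dots> = -1"
    using indep by (simp add: field_simps)
  finally show ?thesis .
qed

lemma riemannian_hyperbolic:
  assumes "c > 0"
  shows "riemannian_metric_on hyperbolic_space (\<lambda>x. c *\<^sub>R hyperbolic_metric x)"
  using assms
  by (auto simp: riemannian_metric_on_def hyperbolic_metric_alt transpose_scalar transpose_mat
      simp del: scaleR_scaleR mem_ball simp flip: scaleR_matrix_vector_assoc
      intro!: mult_pos_pos divide_pos_pos dest!: ball_D)

lemma DERIV_factor2:
  assumes "(x :: real ^ 'm::finite) \<in> ball 0 1"
  shows "((\<lambda>s. 16 * c * (x + s *\<^sub>R axis j 1) $ i / (1 - (x + s *\<^sub>R axis j 1) \<bullet> (x + s *\<^sub>R axis j 1))^3 * d)
     has_real_derivative
       (16 * c * kron j i / (1 - x \<bullet> x)^3 + 96 * c * x $ i * x $ j / (1 - x \<bullet> x)^4) * d) (at 0)"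
proof (rule DERIV_cmult_right, unfold inner_line comp_line)
  define r where "r = 1 - x \<bullet> x"
  have r: "r \<noteq> 0" using ball_D[OF assms] by (simp add: r_def)
  have "((\<lambda>s. 16 * c * (x $ i + s * kron j i) / (1 - (x \<bullet> x + 2 * s * x $ j + s * s))^3)
    has_real_derivative
    (16 * c * kron j i * r^3 - 16 * c * x $ i * (3 * r\<^sup>2 * (- 2 * (x $ j)))) / (r^3 * r^3)) (at 0)"
    using r by (auto intro!: derivative_eq_intros DERIV_denominator simp: r_def)
  moreover have "(16 * c * kron j i * r^3 - 16 * c * x $ i * (3 * r\<^sup>2 * (- 2 * (x $ j)))) / (r^3 * r^3)
    = 16 * c * kron j i / r^3 + 96 * c * x $ i * x $ j / r^4"
    using r by (simp add: field_simps power2_eq_square power3_eq_cube power4_eq_xxxx)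
  ultimately show "((\<lambda>s. 16 * c * (x $ i + s * kron j i) / (1 - (x \<bullet> x + 2 * s * x $ j + s * s))^3)
    has_real_derivative 16 * c * kron j i / (1 - x \<bullet> x)^3 + 96 * c * x $ i * x $ j / (1 - x \<bullet> x)^4) (at 0)"
    by (simp add: r_def)
qed

lemma partial_differentiableI:
  "((\<lambda>s. f (x + s *\<^sub>R axis i 1)) has_real_derivative D) (at 0) \<Longrightarrow> partial_differentiable i f x"
  by (auto simp: partial_differentiable_def field_differentiable_def)

lemma partial_differentiable_cong:
  assumes "open M" "x \<in> M" "\<And>y. y \<in> M \<Longrightarrow> f y = h y"
  shows "partial_differentiable i f x = partial_differentiable i h x"
  unfolding partial_differentiable_def field_differentiable_def
  by (rule ex_cong1, rule DERIV_cong_ev[OF refl eventually_mono[OF eventually_in_open[OF assms(1,2)]] refl])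
     (rule assms(3))

lemma yamabe_flow_hyperbolic:
  defines "a \<equiv> \<lambda>t. real CARD('m::finite) * (real CARD('m) - 1) * t + 1"
  shows "yamabe_flow_on hyperbolic_space T (\<lambda>t (x :: real ^ 'm). a t *\<^sub>R hyperbolic_metric x)"
  unfolding yamabe_flow_on_def
proof (intro conjI ballI allI)
  let ?K = "real CARD('m) * (real CARD('m) - 1)"
  let ?B = "hyperbolic_space :: (real ^ 'm) set"
  have "0 \<le> ?K" by simp
  then have a: "a t > 0" if "t \<in> time_interval T" for t
    using that by (auto simp: a_def time_interval_def intro!: add_nonneg_pos mult_nonneg_nonneg)
  have da: "(a has_real_derivative ?K) (at t within I)" for t I
    unfolding a_def by (auto intro!: derivative_eq_intros)
  show "riemannian_metric_on ?B (\<lambda>x. a t *\<^sub>R hyperbolic_metric x)"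
    if "t \<in> time_interval T" for t
    by (rule riemannian_hyperbolic[OF a[OF that]])
  show "((\<lambda>s. a s *\<^sub>R hyperbolic_metric x) has_vector_derivative
      - scalar_curvature (\<lambda>x. a t *\<^sub>R hyperbolic_metric x) x *\<^sub>R a t *\<^sub>R hyperbolic_metric x)
      (at t within time_interval T)" if t: "t \<in> time_interval T" and x: "x \<in> ?B" for t x
  proof -
    have "a t \<noteq> 0" using a[OF t] by simp
    then have "- scalar_curvature (\<lambda>x. a t *\<^sub>R hyperbolic_metric x) x *\<^sub>R a t *\<^sub>R hyperbolic_metric x
      = ?K *\<^sub>R hyperbolic_metric x"
      by (simp add: scalar_curvature_hyperbolic[OF x])
    moreover have "((\<lambda>s. a s *\<^sub>R hyperbolic_metric x) has_vector_derivative ?K *\<^sub>R hyperbolic_metric x)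
      (at t within time_interval T)"
      using has_vector_derivative_scaleR[OF da has_vector_derivative_const] by simp
    ultimately show ?thesis by simp
  qed
  fix k l :: 'm
  let ?f = "\<lambda>t x :: real ^ 'm. (a t *\<^sub>R hyperbolic_metric x) $ k $ l"
  let ?g = "\<lambda>i t x :: real ^ 'm. 16 * a t * x $ i / (1 - x \<bullet> x)^3 * kron k l"
  let ?h = "\<lambda>i j t x :: real ^ 'm. (16 * a t * kron j i / (1 - x \<bullet> x)^3
      + 96 * a t * x $ i * x $ j / (1 - x \<bullet> x)^4) * kron k l"
  have f: "?f t x = 4 * a t / (1 - x \<bullet> x)\<^sup>2 * kron k l" for t x
    unfolding hyperbolic_metric_alt conformal_component ..
  have g: "partial_deriv i (?f t) x = ?g i t x" if "x \<in> ?B" for i t x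
    by (rule partial_deriv_hyperbolic[OF that])
  have h: "partial_deriv j (partial_deriv i (?f t)) x = ?h i j t x" if x: "x \<in> ?B" for i j t x
  proof -
    have "partial_deriv j (partial_deriv i (?f t)) x = partial_deriv j (?g i t) x"
      by (rule partial_deriv_cong[OF open_ball x g])
    also have "\<dots> = ?h i j t x"
      by (rule partial_deriv_eqI[OF DERIV_factor2[OF x]])
    finally show ?thesis .
  qed
  show "C21_on ?B (time_interval T) ?f"
    unfolding C21_on_def
  proof (intro conjI allI ballI exI)
    show "continuous_on (time_interval T \<times> ?B) (\<lambda>(t, x). ?f t x)"
      unfolding f unfolding a_def case_prod_beta by (intro continuous_intros) (auto dest!: ball_D simp del: mem_ball mem_ball_0)
    show "partial_differentiable i (?f t) x" if "x \<in> ?B" for i t x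
      by (rule partial_differentiableI, unfold f)
         (rule DERIV_cmult_right[OF DERIV_factor[OF that]])
    have gc: "continuous_on (time_interval T \<times> ?B) (\<lambda>(t, x). ?g i t x)" for i
      unfolding a_def case_prod_beta by (intro continuous_intros) (auto dest!: ball_D simp del: mem_ball mem_ball_0)
    show "continuous_on (time_interval T \<times> ?B) (\<lambda>(t, x). partial_deriv i (?f t) x)" for i
      using gc[of i] 
      by (rule continuous_on_eq) (clarsimp simp only: split_paired_all mem_Sigma_iff case_prod_conv g)
    show "partial_differentiable j (partial_deriv i (?f t)) x" if x: "x \<in> ?B" for i j t x
    proof -
      have "partial_differentiable j (partial_deriv i (?f t)) x = partial_differentiable j (?g i t) x"
        by (rule partial_differentiable_cong[OF open_ball x g])
      then show ?thesis
        using partial_differentiableI[OF DERIV_factor2[OF x]] by blast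
    qed
    have hc: "continuous_on (time_interval T \<times> ?B) (\<lambda>(t, x). ?h i j t x)" for i j
      unfolding a_def case_prod_beta by (intro continuous_intros) (auto dest!: ball_D simp del: mem_ball mem_ball_0)
    show "continuous_on (time_interval T \<times> ?B) (\<lambda>(t, x). partial_deriv j (partial_deriv i (?f t)) x)" for i j
      using hc[of j i] 
      by (rule continuous_on_eq) (clarsimp simp only: split_paired_all mem_Sigma_iff case_prod_conv h)
    show "((\<lambda>s. ?f s x) has_real_derivative ?K * (4 / (1 - x \<bullet> x)\<^sup>2 * kron k l)) (at t within time_interval T)" for t x
      using DERIV_cmult_right[OF da, of "4 / (1 - x \<bullet> x)\<^sup>2 * kron k l"]
      unfolding f by (simp add: mult_ac)
    show "continuous_on (time_interval T \<times> ?B) (\<lambda>(t, x). ?K * (4 / (1 - x \<bullet> x)\<^sup>2 * kron k l))"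
      unfolding case_prod_beta by (intro continuous_intros) (auto dest!: ball_D simp del: mem_ball mem_ball_0)
  qed
qed

end

theory Submission
  imports Defs
begin

text \<open>
  All components of the flow solve the same linear ODE in time, so the flow stays conformally flat,
  \<open>g = e\<^sup>f \<delta>\<close>, and becomes \<open>\<partial>\<^sub>t f = (m - 1) e\<^bsup>-f\<^esup> \<Sum>\<^sub>i (\<partial>\<^sub>i\<partial>\<^sub>i f + p (\<partial>\<^sub>i f)\<^sup>2)\<close>
  with \<open>p = (m - 2) / 4\<close>. It is trapped between two families of barriers.

  From above: the hyperbolic metric of a smaller ball of radius \<open>r\<close>, expanding slightly too fast, is
  infinite on the boundary of that ball, where the flow is bounded on compact time intervals; let \<open>r \<rightarrow> 1\<close>.

  From below nothing is known near infinity, so the barrier has to vanish there. It is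
  \<open>(1 + m (m - 1) t) F\<^bsup>1/p\<^esup>\<close> times the hyperbolic metric, where
  \<open>F = (1 + \<epsilon> e\<^bsup>Ct\<^esup> / (1 - |x|\<^sup>2))\<^bsup>-k\<^esup> - \<epsilon>\<close> is an inward travelling front. The power \<open>k = 4 m - 1\<close>
  makes \<open>F\<close> subharmonic near the edge of its support, and the speed \<open>C\<close> absorbs the negative
  Laplacian elsewhere; let \<open>\<epsilon> \<rightarrow> 0\<close>.
\<close>

section \<open>Scalar curvature of a conformally flat metric\<close>

lemma partial_differentiableD:
  "partial_differentiable i f x \<Longrightarrow>
    ((\<lambda>s. f (x + s *\<^sub>R axis i 1)) has_real_derivative partial_deriv i f x) (at 0)"
  by (simp add: partial_differentiable_def partial_deriv_def DERIV_deriv_iff_field_differentiable)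

text \<open>Existence of iterated partial derivatives is what the curvature formula and the touching
  argument use, as both work along coordinate lines.\<close>

definition twice_partial_differentiable_on ::
    "(real ^ 'm::finite) set \<Rightarrow> (real ^ 'm \<Rightarrow> real) \<Rightarrow> bool" where
  "twice_partial_differentiable_on M f \<longleftrightarrow>
     (\<forall>i. \<forall>x\<in>M. partial_differentiable i f x) \<and>
     (\<forall>i j. \<forall>x\<in>M. partial_differentiable j (partial_deriv i f) x)"

text \<open>Times \<open>- (m - 1) * exp (- f x)\<close>, this is the scalar curvature of
  \<open>exp (f x) *\<^sub>R mat 1\<close>. With \<open>p = (m - 2) / 4\<close> and
  \<open>m > 2\<close>, it is also the Euclidean Laplacian of \<open>v = exp (p * f)\<close> divided
  by \<open>p * v\<close>. This linear form is the reason for the exponent \<open>1 / p\<close> in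
  the lower barrier.\<close>

definition conformal_laplacian :: "(real ^ 'm::finite \<Rightarrow> real) \<Rightarrow> real ^ 'm \<Rightarrow> real" where
  "conformal_laplacian f x =
     (\<Sum>i\<in>UNIV. partial_deriv i (partial_deriv i f) x
        + (real CARD('m) - 2) / 4 * (partial_deriv i f x)\<^sup>2)"

text \<open>Every derivative of the metric carries a factor \<open>exp (f x)\<close>, which cancels
  against the inverse metric.\<close>

lemma christoffel_conformally_flat:
  fixes f :: "real ^ 'm::finite \<Rightarrow> real"
  assumes M: "open M" "x \<in> M" and g: "\<And>y. y \<in> M \<Longrightarrow> g y = exp (f y) *\<^sub>R mat 1"
    and f: "\<And>i. partial_differentiable i f x"
  shows "christoffel g k i j x =
    (kron j k * partial_deriv i f x + kron i k * partial_deriv j f x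
      - kron i j * partial_deriv k f x) / 2"
proof -
  have pg: "partial_deriv i (\<lambda>y. g y $ j $ l) x = exp (f x) * partial_deriv i f x * kron j l" for i j l
  proof -
    have "partial_deriv i (\<lambda>y. g y $ j $ l) x = partial_deriv i (\<lambda>y. exp (f y) * kron j l) x"
      by (rule partial_deriv_cong[OF M]) (simp only: g conformal_component)
    also have "\<dots> = exp (f x) * partial_deriv i f x * kron j l"
      by (rule partial_deriv_eqI)
        (use DERIV_cmult_right[OF DERIV_fun_exp[OF partial_differentiableD[OF f]]] in simp)
    finally show ?thesis .
  qed
  have inv: "matrix_inv (g x) $ k $ l = exp (- f x) * kron k l" for k l
    unfolding g[OF M(2)]
    by (simp add: matrix_inv_scaleR_mat conformal_component exp_minus inverse_eq_divide
        del: vector_scaleR_component)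
  have "christoffel g k i j x = (\<Sum>l\<in>UNIV. kron k l * (exp (- f x) *
     (exp (f x) * partial_deriv i f x * kron j l + exp (f x) * partial_deriv j f x * kron i l
      - exp (f x) * partial_deriv l f x * kron i j))) / 2"
    unfolding christoffel_def pg inv by (simp only: mult_ac)
  also have "\<dots> = exp (- f x) * exp (f x) *
     (kron j k * partial_deriv i f x + kron i k * partial_deriv j f x
      - kron i j * partial_deriv k f x) / 2"
    unfolding sum_kron by (simp add: algebra_simps)
  also have "exp (- f x) * exp (f x) = 1"
    by (simp flip: exp_add)
  finally show ?thesis by simp
qed

text \<open>The inverse metric is a multiple of the identity, so only the components
  \<open>riemann g i j i j\<close> enter, and they are summed over \<open>i\<close> and
  \<open>j\<close>.\<close>

lemma scalar_curvature_conformally_flat: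
  fixes f :: "real ^ 'm::finite \<Rightarrow> real"
  assumes M: "open M" "x \<in> M" and g: "\<And>y. y \<in> M \<Longrightarrow> g y = exp (f y) *\<^sub>R mat 1"
    and f: "twice_partial_differentiable_on M f"
  shows "scalar_curvature g x = - (real CARD('m) - 1) * exp (- f x) * conformal_laplacian f x"
proof -
  define F where "F i = partial_deriv i f x" for i
  define G where "G i = partial_deriv i (partial_deriv i f) x" for i
  define S where "S = (\<Sum>i\<in>UNIV. F i * F i)"
  have f1: "partial_differentiable i f y" if "y \<in> M" for i y
    using f that by (auto simp: twice_partial_differentiable_on_def)
  have f2: "partial_differentiable j (partial_deriv i f) x" for i j
    using f M by (auto simp: twice_partial_differentiable_on_def)
  note chr = christoffel_conformally_flat[OF M(1) _ g f1]
  have chrx: "christoffel g k i j x = (kron j k * F i + kron i k * F j - kron i j * F k) / 2" for k i j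
    unfolding F_def by (rule chr[OF M(2)]) (auto intro: M)
  have dchr: "partial_deriv l (christoffel g k i j) x =
    (kron j k * partial_deriv l (partial_deriv i f) x + kron i k * partial_deriv l (partial_deriv j f) x
      - kron i j * partial_deriv l (partial_deriv k f) x) / 2" for l k i j
  proof -
    have "partial_deriv l (christoffel g k i j) x = partial_deriv l (\<lambda>y.
      (kron j k * partial_deriv i f y + kron i k * partial_deriv j f y
        - kron i j * partial_deriv k f y) / 2) x"
      by (rule partial_deriv_cong[OF M]) (rule chr)
    also have "\<dots> = (kron j k * partial_deriv l (partial_deriv i f) x
      + kron i k * partial_deriv l (partial_deriv j f) x
      - kron i j * partial_deriv l (partial_deriv k f) x) / 2"
      by (rule partial_deriv_eqI)
        (intro DERIV_cdivide DERIV_diff DERIV_add DERIV_cmult partial_differentiableD f2)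
    finally show ?thesis .
  qed
  \<comment> \<open>The \<open>kron i j\<close> correction makes the right side vanish for
    \<open>i = j\<close>, as the antisymmetry of the curvature demands.\<close>
  have riem: "riemann g i j i j x = - G i / 2 - G j / 2 + (F i * F i + F j * F j) / 4 - S / 4
      - kron i j * (- G i + F i * F i / 2 - S / 4)" for i j
  proof -
    \<comment> \<open>The quadratic part of the curvature. The summands are arranged so that the
      index \<open>p\<close> is either tied by a \<open>kron\<close> or occurs in
      \<open>F p * F p\<close>, whose sum is \<open>S\<close>; each term can then be summed at
      once.\<close>
    have q1: "(\<Sum>p\<in>UNIV. christoffel g i i p x * christoffel g p j j x) = F j * F j / 2 - S / 4"
    proof -
      have "(\<Sum>p\<in>UNIV. christoffel g i i p x * christoffel g p j j x)
         = (\<Sum>p\<in>UNIV. kron j p * (F j * F p / 2) - F p * F p / 4)"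
        by (intro sum.cong refl; case_tac "i = j"; case_tac "p = i"; case_tac "p = j"; simp add: chrx kron_def; simp add: field_simps)
      then show ?thesis unfolding sum_subtractf sum_kron S_def by (simp add: sum_divide_distrib)
    qed
    have q2: "(\<Sum>p\<in>UNIV. christoffel g i j p x * christoffel g p i j x)
       = (2 * kron i j * (F i * F i) + F j * F j - F i * F i - kron i j * S) / 4"
    proof -
      have "(\<Sum>p\<in>UNIV. christoffel g i j p x * christoffel g p i j x)
        = (\<Sum>p\<in>UNIV. kron i p * ((F j * F j + kron j p * F i * F j - kron i j * F j * F p) / 4)
            + kron i j * (kron j p * (F p * F i / 4)) + kron i j * (kron i p * (F p * F j / 4))
            - kron i j * (F p * F p / 4)
            - kron j p * (F i * F i / 4) - kron j p * (kron i p * (F i * F j / 4))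
            + kron i j * (kron j p * (F i * F p / 4)))"
        by (intro sum.cong refl; case_tac "i = j"; case_tac "p = i"; case_tac "p = j"; simp add: chrx kron_def; simp add: field_simps)
      also have "\<dots> = (F j * F j + kron j i * F i * F j - kron i j * F j * F i) / 4
            + kron i j * (F j * F i / 4) + kron i j * (F i * F j / 4)
            - kron i j * (S / 4)
            - F i * F i / 4 - kron i j * (F i * F j / 4)
            + kron i j * (F i * F j / 4)"
        unfolding sum_subtractf sum.distrib sum_distrib_left[symmetric] sum_kron S_def
        by (simp add: sum_divide_distrib)
      also have "\<dots> = (2 * kron i j * (F i * F i) + F j * F j - F i * F i - kron i j * S) / 4"
        by (auto simp: kron_def)
      finally show ?thesis .
    qed
    show ?thesis
      unfolding riemann_def sum_subtractf q1 q2 dchr G_def[symmetric]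
      by (auto simp: kron_def G_def field_simps)
  qed
  have ric: "(\<Sum>j\<in>UNIV. ricci g j j x) =
     - (real CARD('m) - 1) * ((\<Sum>i\<in>UNIV. G i) + (real CARD('m) - 2) / 4 * S)"
  proof -
    have "(\<Sum>j\<in>UNIV. ricci g j j x) = (\<Sum>j\<in>UNIV. \<Sum>i\<in>UNIV.
      - (1/2) * G i - G j / 2 + ((1/4) * (F i * F i) + F j * F j / 4) - S / 4
      - kron i j * (- G i + F i * F i / 2 - S / 4))"
      unfolding ricci_def riem by (simp add: field_simps)
    also have "\<dots> = (\<Sum>j\<in>UNIV. - (1/2) * (\<Sum>i\<in>UNIV. G i) - real CARD('m) * (G j / 2)
        + ((1/4) * S + real CARD('m) * (F j * F j / 4)) - real CARD('m) * (S / 4)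
        - (- G j + F j * F j / 2 - S / 4))"
      unfolding sum_subtractf sum.distrib sum_distrib_left[symmetric] sum_kron S_def[symmetric]
      by (simp add: sum_divide_distrib[symmetric] sum_distrib_left[symmetric])
    also have "\<dots> = (\<Sum>j\<in>UNIV. - (1/2) * (\<Sum>i\<in>UNIV. G i) + S / 2 - real CARD('m) * (S / 4)
        + (1 - real CARD('m) / 2) * G j + (real CARD('m) / 4 - 1/2) * (F j * F j))"
      by (rule sum.cong) (auto simp: field_simps)
    also have "\<dots> = real CARD('m) * (- (1/2) * (\<Sum>i\<in>UNIV. G i) + S / 2 - real CARD('m) * (S / 4))
       + (1 - real CARD('m) / 2) * (\<Sum>i\<in>UNIV. G i) + (real CARD('m) / 4 - 1/2) * S"
      unfolding sum.distrib sum_subtractf sum_distrib_left[symmetric] S_def[symmetric]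
      by (simp add: algebra_simps sum_divide_distrib[symmetric] sum_distrib_left[symmetric])
    also have "\<dots> = - (real CARD('m) - 1) * ((\<Sum>i\<in>UNIV. G i) + (real CARD('m) - 2) / 4 * S)"
      by (simp add: field_simps)
    finally show ?thesis .
  qed
  have inv: "matrix_inv (g x) $ k $ l = exp (- f x) * kron k l" for k l
    unfolding g[OF M(2)]
    by (simp add: matrix_inv_scaleR_mat conformal_component exp_minus inverse_eq_divide
        del: vector_scaleR_component)
  have "scalar_curvature g x = (\<Sum>j\<in>UNIV. \<Sum>k\<in>UNIV. kron j k * (exp (- f x) * ricci g j k x))"
    unfolding scalar_curvature_def inv by (simp only: mult_ac)
  also have "\<dots> = exp (- f x) * (\<Sum>j\<in>UNIV. ricci g j j x)"
    unfolding sum_kron by (simp add: sum_distrib_left)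
  also have "(\<Sum>i\<in>UNIV. G i) + (real CARD('m) - 2) / 4 * S = conformal_laplacian f x"
    unfolding conformal_laplacian_def G_def S_def F_def
    by (simp add: sum.distrib sum_distrib_left power2_eq_square)
  then have "(\<Sum>j\<in>UNIV. ricci g j j x) = - (real CARD('m) - 1) * conformal_laplacian f x"
    using ric by simp
  finally show ?thesis by simp
qed

section \<open>The conformal Laplacian at touching points and of radial functions\<close>

text \<open>If \<open>D\<close> were positive, \<open>d'\<close> would be positive just to the right
  of its zero at 0, and \<open>d\<close> would increase there beyond its maximum.\<close>

lemma local_max_second_derivative:
  fixes d d' :: "real \<Rightarrow> real"
  assumes "e > 0" and d: "\<And>s. \<bar>s\<bar> < e \<Longrightarrow> (d has_real_derivative d' s) (at s)"
    and d2: "(d' has_real_derivative D) (at 0)"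
    and mx: "\<And>s. \<bar>s\<bar> < e \<Longrightarrow> d s \<le> d 0"
  shows "d' 0 = 0" and "D \<le> 0"
proof -
  show z: "d' 0 = 0"
    by (rule DERIV_local_max[OF d]) (use assms in auto)
  show "D \<le> 0"
  proof (rule ccontr)
    assume "\<not> D \<le> 0"
    then obtain r where r: "r > 0" "\<And>h. 0 < h \<Longrightarrow> h < r \<Longrightarrow> d' 0 < d' (0 + h)"
      using DERIV_pos_inc_right[OF d2] by force
    define s where "s = min r e / 2"
    have s: "0 < s" "s < r" "s < e" using r(1) \<open>e > 0\<close> by (auto simp: s_def)
    have "d 0 < d s"
    proof (rule DERIV_pos_imp_increasing_open[OF s(1)])
      show "\<exists>y. (d has_real_derivative y) (at x) \<and> 0 < y" if "0 < x" "x < s" for x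
        using d[of x] r(2)[of x] that s z by auto
      show "continuous_on {0..s} d"
        by (intro continuous_at_imp_continuous_on ballI DERIV_isCont[OF d]) (use s in auto)
    qed
    then show False using mx[of s] s by auto
  qed
qed

text \<open>Along each coordinate line through \<open>x\<close> the difference \<open>f - h\<close>
  has a maximum at \<open>x\<close>. First derivatives therefore agree, so the quadratic gradient
  terms coincide, and the pure second derivatives are ordered.\<close>

lemma conformal_laplacian_touching:
  fixes f h :: "real ^ 'm::finite \<Rightarrow> real"
  assumes M: "open M" "x \<in> M"
    and f: "twice_partial_differentiable_on M f" and h: "twice_partial_differentiable_on M h"
    and le: "\<And>y. y \<in> M \<Longrightarrow> f y \<le> h y" and eq: "f x = h x"
  shows "conformal_laplacian f x \<le> conformal_laplacian h x"
proof -
  have *: "partial_deriv i f x = partial_deriv i h x \<and>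
      partial_deriv i (partial_deriv i f) x \<le> partial_deriv i (partial_deriv i h) x" for i
  proof -
    define l where "l s = x + s *\<^sub>R axis i (1::real)" for s
    obtain e where e: "e > 0" "\<And>s. \<bar>s\<bar> < e \<Longrightarrow> l s \<in> M"
      using eventually_in_open[OF M, of i]
      by (auto simp: eventually_nhds_metric l_def dist_real_def)
    have D: "((\<lambda>s. k (l s)) has_real_derivative partial_deriv i k (l s)) (at s)"
      if "partial_differentiable i k (l s)" for k s
    proof -
      have "((\<lambda>u. k (l (u + s))) has_real_derivative partial_deriv i k (l s)) (at 0)"
        using partial_differentiableD[OF that] by (simp add: l_def algebra_simps)
      then show ?thesis using DERIV_shift[of "\<lambda>u. k (l u)" _ 0 s] by simp
    qed
    have l0: "l 0 = x" by (simp add: l_def)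
    let ?d = "\<lambda>s. f (l s) - h (l s)"
    let ?d' = "\<lambda>s. partial_deriv i f (l s) - partial_deriv i h (l s)"
    let ?D = "partial_deriv i (partial_deriv i f) x - partial_deriv i (partial_deriv i h) x"
    have d: "(?d has_real_derivative ?d' s) (at s)" if "\<bar>s\<bar> < e" for s
      using f h e(2)[OF that]
      by (intro DERIV_diff D) (auto simp: twice_partial_differentiable_on_def)
    have "(?d' has_real_derivative partial_deriv i (partial_deriv i f) (l 0) - partial_deriv i (partial_deriv i h) (l 0)) (at 0)"
      using f h M l0
      by (intro DERIV_diff D) (auto simp: twice_partial_differentiable_on_def)
    then have d2: "(?d' has_real_derivative ?D) (at 0)" by (simp add: l0)
    have mx: "?d s \<le> ?d 0" if "\<bar>s\<bar> < e" for s
      using le[OF e(2)[OF that]] eq by (simp add: l0)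
    show ?thesis
      using local_max_second_derivative[of e ?d ?d' ?D, OF e(1) d d2 mx] by (simp add: l0)
  qed
  show ?thesis
    unfolding conformal_laplacian_def using * by (intro sum_mono) auto
qed

text \<open>Profiles are functions of the squared norm, which is smooth at the origin, so the chain
  rule covers all points alike.\<close>

lemma radial_conformal_laplacian:
  fixes M :: "(real ^ 'm::finite) set"
  assumes M: "open M"
    and f: "\<And>y. y \<in> M \<Longrightarrow> (f has_real_derivative f' (y \<bullet> y)) (at (y \<bullet> y))"
    and f': "\<And>y. y \<in> M \<Longrightarrow> (f' has_real_derivative f'' (y \<bullet> y)) (at (y \<bullet> y))"
  shows "twice_partial_differentiable_on M (\<lambda>y. f (y \<bullet> y))"
    and "x \<in> M \<Longrightarrow> conformal_laplacian (\<lambda>y. f (y \<bullet> y)) x =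
      4 * (x \<bullet> x) * (f'' (x \<bullet> x) + (real CARD('m) - 2) / 4 * (f' (x \<bullet> x))\<^sup>2)
      + 2 * real CARD('m) * f' (x \<bullet> x)"
proof -
  have ch: "((\<lambda>s. k ((y + s *\<^sub>R axis i 1) \<bullet> (y + s *\<^sub>R axis i 1))) has_real_derivative
       k' * (2 * y $ i)) (at 0)"
    if "(k has_real_derivative k') (at (y \<bullet> y))" for k k' i and y :: "real ^ 'm"
  proof -
    have "((\<lambda>s. y \<bullet> y + 2 * s * y $ i + s * s) has_real_derivative 2 * y $ i) (at 0)"
      by (auto intro!: derivative_eq_intros)
    then show ?thesis
      unfolding inner_line using DERIV_chain'[of _ _ 0 UNIV k k'] that by simp
  qed
  note p1 = ch[OF f]
  have p1': "partial_deriv i (\<lambda>y. f (y \<bullet> y)) y = f' (y \<bullet> y) * (2 * y $ i)" if "y \<in> M" for y i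
    by (rule partial_deriv_eqI[OF p1[OF that]])
  have p2: "((\<lambda>s. f' ((y + s *\<^sub>R axis j 1) \<bullet> (y + s *\<^sub>R axis j 1)) * (2 * (y + s *\<^sub>R axis j 1) $ i))
      has_real_derivative f'' (y \<bullet> y) * (2 * y $ j) * (2 * y $ i) + 2 * kron j i * f' (y \<bullet> y)) (at 0)"
    if "y \<in> M" for y i j
  proof -
    have "((\<lambda>s. 2 * (y + s *\<^sub>R axis j 1) $ i) has_real_derivative 2 * kron j i) (at 0)"
      unfolding comp_line by (auto intro!: derivative_eq_intros)
    from DERIV_mult[OF ch[OF f'[OF that]] this] show ?thesis by simp
  qed
  have p2d: "partial_differentiable j (partial_deriv i (\<lambda>y. f (y \<bullet> y))) y" if "y \<in> M" for y i j
    using partial_differentiable_cong[OF M that p1'] partial_differentiableI[OF p2[OF that]]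
    by simp
  show "twice_partial_differentiable_on M (\<lambda>y. f (y \<bullet> y))"
    using p2d partial_differentiableI[OF p1] by (auto simp: twice_partial_differentiable_on_def)
  show "conformal_laplacian (\<lambda>y. f (y \<bullet> y)) x =
      4 * (x \<bullet> x) * (f'' (x \<bullet> x) + (real CARD('m) - 2) / 4 * (f' (x \<bullet> x))\<^sup>2)
      + 2 * real CARD('m) * f' (x \<bullet> x)" if x: "x \<in> M"
  proof -
    have p2': "partial_deriv i (partial_deriv i (\<lambda>y. f (y \<bullet> y))) x =
        f'' (x \<bullet> x) * (2 * x $ i) * (2 * x $ i) + 2 * f' (x \<bullet> x)" for i
      using partial_deriv_cong[OF M x p1'] partial_deriv_eqI[OF p2[OF x]] by simp
    have "conformal_laplacian (\<lambda>y. f (y \<bullet> y)) x =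
      (\<Sum>i\<in>UNIV. 4 * (f'' (x \<bullet> x) + (real CARD('m) - 2) / 4 * (f' (x \<bullet> x))\<^sup>2) * (x $ i * x $ i)
         + 2 * f' (x \<bullet> x))"
      unfolding conformal_laplacian_def p2' p1'[OF x]
      by (rule sum.cong) (auto simp: algebra_simps power2_eq_square)
    also have "\<dots> = 4 * (f'' (x \<bullet> x) + (real CARD('m) - 2) / 4 * (f' (x \<bullet> x))\<^sup>2) * (x \<bullet> x)
         + real CARD('m) * (2 * f' (x \<bullet> x))"
      unfolding sum.distrib sum_distrib_left[symmetric] inner_vec_def by simp
    finally show ?thesis by (simp add: mult_ac)
  qed
qed

section \<open>First contact and comparison with barriers\<close>

text \<open>If \<open>\<theta>\<close> were nonnegative somewhere, the compact set of such points
  would contain one of least time, positive by \<open>init\<close>. Before that time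
  \<open>\<theta>\<close> is negative, hence by continuity from the left at most 0 on all of
  \<open>K\<close> at that time. This gives \<open>contact\<close> both the spatial and the temporal
  ordering.\<close>

lemma first_contact:
  fixes \<theta> :: "real \<Rightarrow> 'a::metric_space \<Rightarrow> real"
  assumes K: "compact K" and \<theta>: "continuous_on ({0..\<tau>} \<times> K) (\<lambda>(t, x). \<theta> t x)"
    and init: "\<And>x. x \<in> K \<Longrightarrow> \<theta> 0 x < 0"
    and contact: "\<And>t x. \<lbrakk>0 < t; t \<le> \<tau>; x \<in> K; \<theta> t x = 0;
        \<And>s y. \<lbrakk>0 \<le> s; s \<le> t; y \<in> K\<rbrakk> \<Longrightarrow> \<theta> s y \<le> 0\<rbrakk> \<Longrightarrow> False"
    and t: "0 \<le> t" "t \<le> \<tau>" and x: "x \<in> K"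
  shows "\<theta> t x < 0"
proof (rule ccontr)
  assume "\<not> \<theta> t x < 0"
  define S where "S = {z \<in> {0..\<tau>} \<times> K. (\<lambda>(t, x). \<theta> t x) z \<ge> 0}"
  have "S = ({0..\<tau>} \<times> K) \<inter> (\<lambda>(t, x). \<theta> t x) -` {0..}" by (auto simp: S_def)
  then have "closed S"
    using continuous_closed_preimage[OF \<theta> _ closed_atLeast[of 0]] K
    by (simp add: closed_Times compact_imp_closed)
  moreover have "compact ({0..\<tau>} \<times> K)" by (intro compact_Times K compact_Icc)
  ultimately have "compact (({0..\<tau>} \<times> K) \<inter> S)"
    by (intro compact_Int_closed)
  moreover have "({0..\<tau>} \<times> K) \<inter> S = S" by (auto simp: S_def)
  ultimately have "compact S" by simp
  moreover have "(t, x) \<in> S" using \<open>\<not> \<theta> t x < 0\<close> t x by (auto simp: S_def)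
  ultimately obtain t0 x0 where S0: "(t0, x0) \<in> S" and least: "\<And>s y. (s, y) \<in> S \<Longrightarrow> t0 \<le> s"
    using continuous_attains_inf[of S fst] continuous_on_fst[OF continuous_on_id, of S] by fastforce
  have t0: "0 \<le> t0" "t0 \<le> \<tau>" "x0 \<in> K" "\<theta> t0 x0 \<ge> 0" using S0 by (auto simp: S_def)
  then have "t0 > 0" using init[of x0] by (cases "t0 = 0") auto
  have before: "\<theta> s y < 0" if "0 \<le> s" "s < t0" "y \<in> K" for s y
    using least[of s y] that t0 by (cases "\<theta> s y < 0") (auto simp: S_def)
  have at_t0: "\<theta> t0 y \<le> 0" if y: "y \<in> K" for y
  proof -
    have "continuous_on {0..\<tau>} (\<lambda>s. (\<lambda>(t, x). \<theta> t x) (s, y))"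
      by (rule continuous_on_compose2[OF \<theta>]) (use y in \<open>auto intro: continuous_on_Pair\<close>)
    then have "continuous_on {0..t0} (\<lambda>s. \<theta> s y)"
      using t0 by (auto elim: continuous_on_subset)
    then have "((\<lambda>s. \<theta> s y) \<longlongrightarrow> \<theta> t0 y) (at_left t0)"
      using \<open>t0 > 0\<close> by (intro continuous_on_Icc_at_leftD)
    moreover have "eventually (\<lambda>s. \<theta> s y \<le> 0) (at_left t0)"
      using eventually_at_left_real[OF \<open>t0 > 0\<close>]
      by eventually_elim (use before y in \<open>auto intro: less_imp_le\<close>)
    ultimately show ?thesis by (rule tendsto_upperbound) auto
  qed
  have le: "\<theta> s y \<le> 0" if "0 \<le> s" "s \<le> t0" "y \<in> K" for s y
    using before[of s y] at_t0[of y] that by (cases "s = t0") auto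
  show False
    by (rule contact[of t0 x0]) (use t0 \<open>t0 > 0\<close> at_t0 le in \<open>auto intro: antisym\<close>)
qed

lemma left_derivative_nonneg:
  fixes h :: "real \<Rightarrow> real"
  assumes h: "(h has_real_derivative D) (at t within {0..t})" and "0 < t"
    and le: "eventually (\<lambda>s. h s \<le> h t) (at_left t)"
  shows "0 \<le> D"
proof -
  have "at t within {0..t} = at_left t"
    using \<open>0 < t\<close> by (simp add: at_within_Icc_at_left)
  then have "((\<lambda>s. (h s - h t) / (s - t)) \<longlongrightarrow> D) (at_left t)"
    using h by (simp add: has_field_derivative_iff)
  moreover have "eventually (\<lambda>s. 0 \<le> (h s - h t) / (s - t)) (at_left t)"
    using le eventually_at_left_real[OF \<open>0 < t\<close>]
    by eventually_elim (auto simp: divide_simps)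
  ultimately show ?thesis by (rule tendsto_lowerbound) auto
qed

text \<open>The Yamabe flow of \<open>exp (f t x)\<close> times the Euclidean metric, written for
  the logarithm of the conformal factor and started at the Poincare metric.\<close>

locale conformal_yamabe_flow =
  fixes T :: ereal and f :: "real \<Rightarrow> real ^ 'm::finite \<Rightarrow> real"
  assumes dim: "3 \<le> CARD('m)"
    and cont: "continuous_on (time_interval T \<times> hyperbolic_space) (\<lambda>(t, x). f t x)"
    and space: "t \<in> time_interval T \<Longrightarrow> twice_partial_differentiable_on hyperbolic_space (f t)"
    and time: "t \<in> time_interval T \<Longrightarrow> x \<in> hyperbolic_space \<Longrightarrow>
      ((\<lambda>s. f s x) has_real_derivative
         (real CARD('m) - 1) * exp (- f t x) * conformal_laplacian (f t) x)
        (at t within time_interval T)"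
    and init: "x \<in> hyperbolic_space \<Longrightarrow> f 0 x = ln 4 - 2 * ln (1 - x \<bullet> x)"
begin

lemma Icc_subset: "t \<in> time_interval T \<Longrightarrow> {0..t} \<subseteq> time_interval T"
  by (auto simp: time_interval_def intro: order.strict_trans1[of "ereal _" "ereal t"])

lemma time_left:
  assumes "t \<in> time_interval T" "x \<in> hyperbolic_space"
  shows "((\<lambda>s. f s x) has_real_derivative
     (real CARD('m) - 1) * exp (- f t x) * conformal_laplacian (f t) x) (at t within {0..t})"
  by (rule DERIV_subset[OF time[OF assms] Icc_subset[OF assms(1)]])

lemma continuous_on_subcylinder:
  assumes "t \<in> time_interval T" "K \<subseteq> hyperbolic_space"
  shows "continuous_on ({0..t} \<times> K) (\<lambda>z. f (fst z) (snd z))"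
  using cont unfolding case_prod_beta
  by (rule continuous_on_subset) (use assms Icc_subset in auto)

text \<open>At a contact, \<open>b - f\<close> has risen to 0 in time, so \<open>B\<close> is at
  least the speed of \<open>f\<close>. By touching, that speed is at least the one the flow equation
  assigns to \<open>b\<close>, against \<open>strict\<close>. The open set \<open>M\<close> allows
  barriers that live on part of the ball only.\<close>

lemma no_contact_from_below:
  assumes t: "t \<in> time_interval T" "0 < t" and M: "open M" "x \<in> M" "M \<subseteq> hyperbolic_space"
    and b: "twice_partial_differentiable_on M (b t)"
    and bt: "((\<lambda>s. b s x) has_real_derivative B) (at t within {0..t})"
    and strict: "B < (real CARD('m) - 1) * exp (- b t x) * conformal_laplacian (b t) x"
    and eq: "b t x = f t x" and below: "\<And>y. y \<in> M \<Longrightarrow> b t y \<le> f t y"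
    and before: "eventually (\<lambda>s. b s x \<le> f s x) (at_left t)"
  shows False
proof -
  have x: "x \<in> hyperbolic_space" using M by blast
  have fM: "twice_partial_differentiable_on M (f t)"
    using space[OF t(1)] M(3) unfolding twice_partial_differentiable_on_def by blast
  have "0 \<le> B - (real CARD('m) - 1) * exp (- f t x) * conformal_laplacian (f t) x"
    by (rule left_derivative_nonneg[OF DERIV_diff[OF bt time_left[OF t(1) x]] t(2)])
       (use before eq in \<open>auto elim: eventually_mono\<close>)
  moreover have "conformal_laplacian (b t) x \<le> conformal_laplacian (f t) x"
    by (rule conformal_laplacian_touching[OF M(1,2) b fM below eq])
  then have "(real CARD('m) - 1) * exp (- b t x) * conformal_laplacian (b t) x
     \<le> (real CARD('m) - 1) * exp (- b t x) * conformal_laplacian (f t) x"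
    using dim by (intro mult_left_mono) auto
  ultimately show False using strict eq by simp
qed

text \<open>The mirror image for strict supersolutions, with \<open>b\<close> and \<open>f\<close>
  exchanged in the time derivative and in the touching argument.\<close>

lemma no_contact_from_above:
  assumes t: "t \<in> time_interval T" "0 < t" and M: "open M" "x \<in> M" "M \<subseteq> hyperbolic_space"
    and b: "twice_partial_differentiable_on M (b t)"
    and bt: "((\<lambda>s. b s x) has_real_derivative B) (at t within {0..t})"
    and strict: "B > (real CARD('m) - 1) * exp (- b t x) * conformal_laplacian (b t) x"
    and eq: "b t x = f t x" and above: "\<And>y. y \<in> M \<Longrightarrow> f t y \<le> b t y"
    and before: "eventually (\<lambda>s. f s x \<le> b s x) (at_left t)"
  shows False
proof -
  have x: "x \<in> hyperbolic_space" using M by blast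
  have fM: "twice_partial_differentiable_on M (f t)"
    using space[OF t(1)] M(3) unfolding twice_partial_differentiable_on_def by blast
  have "0 \<le> (real CARD('m) - 1) * exp (- f t x) * conformal_laplacian (f t) x - B"
    by (rule left_derivative_nonneg[OF DERIV_diff[OF time_left[OF t(1) x] bt] t(2)])
       (use before eq in \<open>auto elim: eventually_mono\<close>)
  moreover have "conformal_laplacian (f t) x \<le> conformal_laplacian (b t) x"
    by (rule conformal_laplacian_touching[OF M(1,2) fM b above eq[symmetric]])
  then have "(real CARD('m) - 1) * exp (- b t x) * conformal_laplacian (f t) x
     \<le> (real CARD('m) - 1) * exp (- b t x) * conformal_laplacian (b t) x"
    using dim by (intro mult_left_mono) auto
  ultimately show False using strict eq by simp
qed

section \<open>Upper bound by barriers that blow up on smaller balls\<close>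

text \<open>The barrier is a time-dependent multiple \<open>A\<close> of the hyperbolic metric of
  the ball of radius \<open>r\<close>, whose conformal factor is
  \<open>4 * r\<^sup>2 / (r\<^sup>2 - y \<bullet> y)\<^sup>2\<close>.\<close>

lemma upper_barrier:
  assumes t: "t \<in> time_interval T" and r: "0 < r" "r < 1" and x: "norm x < r" and \<sigma>: "0 < \<sigma>"
  shows "exp (f t x) * (r\<^sup>2 - x \<bullet> x)\<^sup>2
    < 4 * r\<^sup>2 * (1 + \<sigma> + (real CARD('m) * (real CARD('m) - 1) + \<sigma>) * t)"
proof -
  define m where "m = real CARD('m)"
  have m: "m \<ge> 3" using dim by (simp add: m_def)
  \<comment> \<open>The \<open>\<sigma>\<close> in the constant term makes the initial inequality
    strict; the one in the slope makes the barrier a strict supersolution.\<close>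
  define A where "A s = 1 + \<sigma> + (m * (m - 1) + \<sigma>) * s" for s
  have A: "A s > 0" if "s \<ge> 0" for s
    using m \<sigma> that by (auto simp: A_def intro!: add_pos_nonneg mult_nonneg_nonneg)
  define b where "b s y = ln (4 * r\<^sup>2 * A s) - 2 * ln (r\<^sup>2 - y \<bullet> y)" for s and y :: "real ^ 'm"
  \<comment> \<open>Multiplication by the square of \<open>r\<^sup>2 - y \<bullet> y\<close> removes
    the singularity of the barrier, so \<open>\<theta>\<close> is continuous on the closed ball and
    negative on its boundary.\<close>
  define \<theta> where "\<theta> s y = exp (f s y) * (r\<^sup>2 - y \<bullet> y)\<^sup>2 - 4 * r\<^sup>2 * A s" for s y
  have inner_less: "y \<bullet> y < r\<^sup>2 \<longleftrightarrow> y \<in> ball 0 r" for y :: "real ^ 'm"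
    using r by (simp add: dot_square_norm flip: abs_less_iff)
      (smt (verit) norm_ge_zero power2_le_imp_le power_mono power_strict_mono zero_less_numeral)
  have exp_b: "exp (b s y) * (r\<^sup>2 - y \<bullet> y)\<^sup>2 = 4 * r\<^sup>2 * A s" if "0 \<le> s" "y \<in> ball 0 r" for s y
  proof -
    have "r\<^sup>2 - y \<bullet> y > 0" using inner_less[of y] that by simp
    moreover have "4 * r\<^sup>2 * A s > 0" using A[OF that(1)] r by simp
    ultimately show ?thesis by (simp add: b_def exp_diff exp_double)
  qed
  have \<theta>b: "\<theta> s y = (exp (f s y) - exp (b s y)) * (r\<^sup>2 - y \<bullet> y)\<^sup>2" if "0 \<le> s" "y \<in> ball 0 r" for s y
    using exp_b[OF that] by (simp add: \<theta>_def algebra_simps)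
  have \<theta>_le: "f s y \<le> b s y" if "\<theta> s y \<le> 0" "0 \<le> s" "y \<in> ball 0 r" for s y
    using that(1) inner_less[of y] that unfolding \<theta>b[OF that(2,3)] by (auto simp: mult_le_0_iff)
  have \<theta>_eq: "f s y = b s y" if "\<theta> s y = 0" "0 \<le> s" "y \<in> ball 0 r" for s y
    using that(1) inner_less[of y] that unfolding \<theta>b[OF that(2,3)] by auto
  have sub: "cball 0 r \<subseteq> (hyperbolic_space :: (real ^ 'm) set)" using r by auto
  have "\<theta> t x < 0"
  proof (rule first_contact[where K = "cball 0 r" and \<tau> = t and \<theta> = \<theta>])
    show "continuous_on ({0..t} \<times> cball 0 r) (\<lambda>(t, x). \<theta> t x)"
      unfolding \<theta>_def A_def case_prod_beta
      by (intro continuous_intros continuous_on_subcylinder[OF t sub])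
    show "\<theta> 0 y < 0" if "y \<in> cball 0 r" for y
    proof -
      define q where "q = y \<bullet> y"
      have q: "0 \<le> q" "q \<le> r\<^sup>2"
        using that by (auto simp: q_def dot_square_norm intro: power_mono)
      have "r\<^sup>2 < 1" using r by (simp add: power_less_one_iff)
      then have q1: "1 - q > 0" using q by simp
      \<comment> \<open>This identity compares the two hyperbolic metrics: the one of the smaller
        ball is the larger, which orders the initial data.\<close>
      have "r * (1 - q) - (r\<^sup>2 - q) = (1 - r) * (r + q)" by (simp add: algebra_simps power2_eq_square)
      then have "r\<^sup>2 - q \<le> r * (1 - q)" using r q by (smt (verit) mult_nonneg_nonneg)
      then have "(r\<^sup>2 - q)\<^sup>2 \<le> (r * (1 - q))\<^sup>2" using q by (intro power_mono) auto
      then have "(r\<^sup>2 - q)\<^sup>2 / (1 - q)\<^sup>2 \<le> r\<^sup>2"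
        using q1 by (simp add: divide_simps power_mult_distrib)
      moreover have "exp (f 0 y) = 4 / (1 - q)\<^sup>2"
      using init[of y] that sub q1 by (auto simp: exp_diff exp_double q_def)
      moreover have "r\<^sup>2 * 1 < r\<^sup>2 * A 0"
        using r \<sigma> by (intro mult_strict_left_mono) (auto simp: A_def)
      ultimately show ?thesis by (simp add: \<theta>_def q_def)
    qed
    show False if s: "0 < s" "s \<le> t" and y: "y \<in> cball 0 r" and eq: "\<theta> s y = 0"
      and le: "\<And>u z. 0 \<le> u \<Longrightarrow> u \<le> s \<Longrightarrow> z \<in> cball 0 r \<Longrightarrow> \<theta> u z \<le> 0" for s y
    proof (rule no_contact_from_above[where t = s and x = y and b = b and M = "ball 0 r"])
      \<comment> \<open>On the boundary sphere \<open>\<theta>\<close> is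
        \<open>- 4 * r\<^sup>2 * A s\<close>, so contact happens inside, where \<open>b\<close> is
        finite.\<close>
      have "y \<bullet> y \<noteq> r\<^sup>2" using eq A[of s] s r by (auto simp: \<theta>_def)
      then have "norm y \<noteq> r" by (auto simp: dot_square_norm)
      then show yb: "y \<in> ball 0 r" using y by simp
      define q where "q = y \<bullet> y"
      have q: "r\<^sup>2 - q > 0" using yb inner_less[of y] by (simp add: q_def)
      show "s \<in> time_interval T" using Icc_subset[OF t] s by auto
      show "0 < s" by fact
      show "open (ball 0 r)" "ball 0 r \<subseteq> (hyperbolic_space :: (real ^ 'm) set)" using r by auto
      show "b s y = f s y" using \<theta>_eq[OF eq] s yb by simp
      show "f s z \<le> b s z" if "z \<in> ball 0 r" for z
        using \<theta>_le[OF le[of s z]] s that by auto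
      show "eventually (\<lambda>u. f u y \<le> b u y) (at_left s)"
        using eventually_at_left_real[OF s(1)]
        by eventually_elim (use \<theta>_le le yb y in auto)
      note rad = radial_conformal_laplacian[where M = "ball 0 r" and
          f = "\<lambda>q. ln (4 * r\<^sup>2 * A s) - 2 * ln (r\<^sup>2 - q)" and
          f' = "\<lambda>q. 2 / (r\<^sup>2 - q)" and f'' = "\<lambda>q. 2 / (r\<^sup>2 - q)\<^sup>2"]
      have d1: "((\<lambda>q. ln (4 * r\<^sup>2 * A s) - 2 * ln (r\<^sup>2 - q)) has_real_derivative 2 / (r\<^sup>2 - z \<bullet> z)) (at (z \<bullet> z))"
        if "z \<in> ball 0 r" for z :: "real ^ 'm"
        using inner_less[of z] that by (auto intro!: derivative_eq_intros simp: field_simps)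
      have d2: "((\<lambda>q. 2 / (r\<^sup>2 - q)) has_real_derivative 2 / (r\<^sup>2 - z \<bullet> z)\<^sup>2) (at (z \<bullet> z))"
        if "z \<in> ball 0 r" for z :: "real ^ 'm"
        using inner_less[of z] that
        by (auto intro!: derivative_eq_intros simp: power2_eq_square)
      show "twice_partial_differentiable_on (ball 0 r) (b s)"
        unfolding b_def by (rule rad(1)[OF open_ball d1 d2])
      have "(A has_real_derivative m * (m - 1) + \<sigma>) (at s within {0..s})"
        unfolding A_def by (auto intro!: derivative_eq_intros)
      then show "((\<lambda>u. b u y) has_real_derivative (m * (m - 1) + \<sigma>) / A s) (at s within {0..s})"
        unfolding b_def using A[of s] s r
        by (auto intro!: derivative_eq_intros simp: field_simps)
      have "conformal_laplacian (b s) y = 4 * q * (2 / (r\<^sup>2 - q)\<^sup>2 + (m - 2) / 4 * (2 / (r\<^sup>2 - q))\<^sup>2)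
          + 2 * m * (2 / (r\<^sup>2 - q))"
        unfolding b_def q_def m_def by (rule rad(2)[OF open_ball d1 d2 yb])
      also have "\<dots> = 4 * m * r\<^sup>2 / (r\<^sup>2 - q)\<^sup>2"
        using q by (simp add: divide_simps) (simp add: algebra_simps power2_eq_square)
      finally have "conformal_laplacian (b s) y * (r\<^sup>2 - q)\<^sup>2 = 4 * m * r\<^sup>2"
        using q by simp
      moreover have "exp (b s y) * (r\<^sup>2 - q)\<^sup>2 = 4 * r\<^sup>2 * A s"
        using exp_b[of s y] s yb by (simp add: q_def)
      ultimately have "(A s * conformal_laplacian (b s) y) * (r\<^sup>2 - q)\<^sup>2
          = (exp (b s y) * m) * (r\<^sup>2 - q)\<^sup>2"
        by algebra
      then have "A s * conformal_laplacian (b s) y = exp (b s y) * m"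
        using q by simp
      \<comment> \<open>Times \<open>m - 1\<close> this is minus the scalar curvature of a
        hyperbolic metric scaled by \<open>A s\<close>. The logarithmic rate of the barrier exceeds
        the resulting \<open>m * (m - 1) / A s\<close> by \<open>\<sigma> / A s\<close>.\<close>
      then have "exp (- b s y) * conformal_laplacian (b s) y = m / A s"
        using A[of s] s by (simp add: exp_minus field_simps)
      then have "(m - 1) * exp (- b s y) * conformal_laplacian (b s) y = (m - 1) * (m / A s)"
        by (simp only: mult.assoc)
      also have "\<dots> = m * (m - 1) / A s" by simp
      also have "\<dots> < (m * (m - 1) + \<sigma>) / A s"
        using A[of s] s \<sigma> by (intro divide_strict_right_mono) auto
      finally show "(real CARD('m) - 1) * exp (- b s y) * conformal_laplacian (b s) y
          < (m * (m - 1) + \<sigma>) / A s"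
        by (simp add: m_def)
    qed
  qed (use t x in \<open>auto simp: time_interval_def\<close>)
  then show ?thesis by (simp add: \<theta>_def A_def m_def)
qed

lemma upper_bound:
  assumes t: "t \<in> time_interval T" and x: "x \<in> hyperbolic_space"
  shows "exp (f t x) * (1 - x \<bullet> x)\<^sup>2 \<le> 4 * (real CARD('m) * (real CARD('m) - 1) * t + 1)"
proof -
  let ?K = "real CARD('m) * (real CARD('m) - 1)"
  \<comment> \<open>The slack is taken as \<open>\<sigma> = 1 - r\<close>, so that a single limit
    \<open>r \<rightarrow> 1\<close> removes both parameters.\<close>
  have "((\<lambda>r. exp (f t x) * (r\<^sup>2 - x \<bullet> x)\<^sup>2) \<longlongrightarrow> exp (f t x) * (1\<^sup>2 - x \<bullet> x)\<^sup>2) (at_left 1)"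
    by (intro tendsto_intros)
  moreover have "((\<lambda>r. 4 * r\<^sup>2 * (1 + (1 - r) + (?K + (1 - r)) * t)) \<longlongrightarrow>
      4 * 1\<^sup>2 * (1 + (1 - 1) + (?K + (1 - 1)) * t)) (at_left 1)"
    by (intro tendsto_intros)
  moreover have "eventually (\<lambda>r. exp (f t x) * (r\<^sup>2 - x \<bullet> x)\<^sup>2
      \<le> 4 * r\<^sup>2 * (1 + (1 - r) + (?K + (1 - r)) * t)) (at_left 1)"
  proof (rule eventually_mono[OF eventually_at_left_real])
    show "norm x < 1" using x by simp
    fix r assume "r \<in> {norm x<..<1}"
    then show "exp (f t x) * (r\<^sup>2 - x \<bullet> x)\<^sup>2 \<le> 4 * r\<^sup>2 * (1 + (1 - r) + (?K + (1 - r)) * t)"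
      using upper_barrier[OF t, of r x "1 - r"] by (auto intro!: less_imp_le le_less_trans[OF norm_ge_zero])
  qed
  ultimately have "exp (f t x) * (1\<^sup>2 - x \<bullet> x)\<^sup>2 \<le> 4 * 1\<^sup>2 * (1 + (1 - 1) + (?K + (1 - 1)) * t)"
    by (intro tendsto_le[OF trivial_limit_at_left_real])
  then show ?thesis by (simp add: algebra_simps)
qed

end

section \<open>Lower bound by inward travelling fronts\<close>

text \<open>
  In the application \<open>A = 1 + m (m - 1) t\<close>, \<open>y = 1 / (1 - |x|\<^sup>2)\<close>, \<open>\<delta> = \<epsilon> e\<^bsup>Ct\<^esup>\<close>, \<open>P = (1 + z)\<^bsup>-k\<^esup>\<close>,
  \<open>F = P - \<epsilon>\<close> and \<open>G = F\<^bsup>1/p\<^esup>\<close>. The front speed \<open>C\<close> is only needed for \<open>z \<le> 1\<close>, where \<open>F\<close> is bounded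
  away from \<open>0\<close>.
\<close>

lemma subsolution_inequality:
  fixes m p A C G P y z F \<delta> k :: real
  assumes m: "3 \<le> m" and p: "p = (m - 2) / 4" and k: "k + 1 = 4 * m"
    and y: "1 \<le> y" and F: "0 < F" and G: "0 < G" "G < 1" and A: "1 \<le> A" and P: "0 < P"
    and z: "z = \<delta> * y" and \<delta>: "0 < \<delta>" "\<delta> \<le> 1 / 2" and C: "0 \<le> C"
    and CG: "z \<le> 1 \<Longrightarrow> m * (m - 1) \<le> C * G"
  shows "m * (m - 1) / A - k * P * z * C / (1 + z) / (p * F)
    < (m - 1) * (1 / (4 * A * y\<^sup>2 * G)) * (4 * m * y\<^sup>2 +
        (4 * k * (k + 1) * P * z\<^sup>2 * (y\<^sup>2 - y) / (1 + z)\<^sup>2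
          - k * P * z * y * (4 * m * y - 2 * m) / (1 + z)) / (p * F))"
proof -
  have p0: "p > 0" and k0: "k > 0" and z0: "z > 0" using m p k y z \<delta> by auto
  \<comment> \<open>\<open>X\<close> is the factor common to all front terms: the time derivative
    contains \<open>- X * C\<close> and the right side equals
    \<open>(m * (m - 1) + X * H) / (A * G)\<close>. After multiplication by \<open>A * G\<close>,
    the claim follows from \<open>G < 1\<close> and a lower bound for \<open>H\<close>.\<close>
  define H where "H = (m - 1) * ((k + 1) * z * (1 - 1 / y) / (1 + z) - (m - m / (2 * y)))"
  define X where "X = k * P * z / (1 + z) / (p * F)"
  have X: "X > 0" unfolding X_def using p0 k0 z0 P F by simp
  \<comment> \<open>For \<open>z \<le> 1\<close> the worst value of \<open>H\<close> is
    \<open>- m * (m - 1)\<close>, which the front speed absorbs through \<open>CG\<close>. For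
    \<open>z > 1\<close>, \<open>\<delta> \<le> 1 / 2\<close> forces \<open>y \<ge> 2\<close>, and
    \<open>k + 1 = 4 * m\<close> is large enough to make \<open>H\<close> nonnegative.\<close>
  have H: "- (A * C * G) \<le> H"
  proof (cases "z \<le> 1")
    case True
    have "(m - 1) * 0 \<le> (m - 1) * ((k + 1) * z * (1 - 1 / y) / (1 + z) + m / (2 * y))"
      using m k0 z0 y by (intro mult_left_mono add_nonneg_nonneg divide_nonneg_nonneg mult_nonneg_nonneg) auto
    then have "- (m * (m - 1)) \<le> H" by (simp add: H_def algebra_simps)
    moreover have "1 * (C * G) \<le> A * (C * G)"
      using A C G by (intro mult_right_mono) auto
    ultimately show ?thesis using CG[OF True] by (simp add: mult_ac)
  next
    case False
    have "\<delta> * y \<le> 1 / 2 * y" using \<delta> y by (intro mult_right_mono) auto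
    then have "y \<ge> 2" using False z by linarith
    then have "1 - 1 / y \<ge> 1 / 2" by (simp add: field_simps)
    then have "(4 * m * z) * (1 / 2) \<le> (4 * m * z) * (1 - 1 / y)"
      using m z0 by (intro mult_left_mono) auto
    moreover have "m * (1 + z) \<le> m * (2 * z)" using m False by (intro mult_left_mono) auto
    ultimately have "m * (1 + z) \<le> (k + 1) * z * (1 - 1 / y)" unfolding k by linarith
    then have "m \<le> (k + 1) * z * (1 - 1 / y) / (1 + z)"
      using z0 by (simp add: le_divide_eq)
    moreover have "m / (2 * y) \<ge> 0" using m y by simp
    ultimately have "0 \<le> (m - 1) * ((k + 1) * z * (1 - 1 / y) / (1 + z) - (m - m / (2 * y)))"
      using m by (intro mult_nonneg_nonneg) auto
    then have "0 \<le> H" by (simp add: H_def)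
    moreover have "0 \<le> A * C * G" using A C G by simp
    ultimately show ?thesis by linarith
  qed
  have "(m - 1) * (1 / (4 * A * y\<^sup>2 * G)) * (4 * m * y\<^sup>2 +
        (4 * k * (k + 1) * P * z\<^sup>2 * (y\<^sup>2 - y) / (1 + z)\<^sup>2
          - k * P * z * y * (4 * m * y - 2 * m) / (1 + z)) / (p * F))
      = (m * (m - 1) + X * H) / (A * G)"
  proof -
    have "(4 * k * (k + 1) * P * z\<^sup>2 * (y\<^sup>2 - y) / (1 + z)\<^sup>2
          - k * P * z * y * (4 * m * y - 2 * m) / (1 + z)) / (p * F)
        = X * (4 * y\<^sup>2 * ((k + 1) * z * (1 - 1 / y) / (1 + z) - (m - m / (2 * y))))"
    proof -
      have e1: "4 * k * (k + 1) * P * z\<^sup>2 * (y\<^sup>2 - y) / (1 + z)\<^sup>2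
         = k * P * z / (1 + z) * (4 * y\<^sup>2 * ((k + 1) * z * (1 - 1 / y) / (1 + z)))"
        using y z0 by (simp add: power2_eq_square divide_simps; simp add: algebra_simps)
      have e2: "k * P * z * y * (4 * m * y - 2 * m) / (1 + z)
         = k * P * z / (1 + z) * (4 * y\<^sup>2 * (m - m / (2 * y)))"
        using y z0 by (simp add: power2_eq_square divide_simps; simp add: algebra_simps)
      have "(a * (c * B) - a * (c * D)) / d = a / d * (c * (B - D))" for a B c D d :: real
        by (simp add: right_diff_distrib diff_divide_distrib)
      then show ?thesis unfolding e1 e2 X_def .
    qed
    moreover have "(m - 1) * (1 / (4 * A * y\<^sup>2 * G)) * (4 * m * y\<^sup>2 + X * (4 * y\<^sup>2 * h))
        = (m * (m - 1) + X * ((m - 1) * h)) / (A * G)" for h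
      using y A G by (simp add: field_simps)
    ultimately show ?thesis unfolding H_def by presburger
  qed
  moreover have "m * (m - 1) / A - k * P * z * C / (1 + z) / (p * F) = m * (m - 1) / A - X * C"
    by (simp add: X_def)
  moreover have "m * (m - 1) / A - X * C < (m * (m - 1) + X * H) / (A * G)"
  proof -
    have "m * (m - 1) * G < m * (m - 1) * 1"
      using m G by (intro mult_strict_left_mono) auto
    moreover have "X * (- (A * C * G)) \<le> X * H"
      using X H by (intro mult_left_mono) auto
    ultimately have "m * (m - 1) * G - X * C * (A * G) < m * (m - 1) + X * H"
      by (simp add: mult_ac)
    moreover have "m * (m - 1) * G - X * C * (A * G) = (m * (m - 1) / A - X * C) * (A * G)"
      using A by (simp add: field_simps)
    ultimately show ?thesis using A G by (simp add: pos_less_divide_eq)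
  qed
  ultimately show ?thesis by linarith
qed

context conformal_yamabe_flow
begin

text \<open>The right side is the \<open>p\<close>-th power of the ratio of the flow to the expected
  solution. The front on the left starts below 1, is at most 0 on the sphere bounding a suitable
  ball, and yields a strict subsolution where it is positive, so the two never meet.\<close>

lemma lower_barrier:
  fixes \<epsilon> C t :: real and x :: "real ^ 'm"
  defines "m \<equiv> real CARD('m)"
  defines "k \<equiv> 4 * m - 1" and "p \<equiv> (m - 2) / 4"
  assumes C: "0 \<le> C" "m * (m - 1) \<le> C * exp (- (k + 1) * ln 2 / p)"
    and t: "t \<in> time_interval T" and x: "x \<in> hyperbolic_space"
    and \<epsilon>: "0 < \<epsilon>" "\<epsilon> * exp (C * t) \<le> 1 / 2" "\<epsilon> \<le> exp (- (k + 1) * ln 2)"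
  shows "exp (- k * ln (1 + \<epsilon> * exp (C * t) / (1 - x \<bullet> x))) - \<epsilon>
    < exp (p * (f t x - (ln (4 * (1 + m * (m - 1) * t)) - 2 * ln (1 - x \<bullet> x))))"
proof -
  have m: "m \<ge> 3" using dim by (simp add: m_def)
  have k: "k \<ge> 1" "k + 1 = 4 * m" and p: "p > 0" using m by (auto simp: k_def p_def)
  define A where "A s = 1 + m * (m - 1) * s" for s
  have A: "A s \<ge> 1" if "s \<ge> 0" for s
    using m that by (auto simp: A_def intro!: mult_nonneg_nonneg)
  define P where "P s q = exp (- k * ln (1 + \<epsilon> * exp (C * s) / (1 - q)))" for s q
  define \<beta> where "\<beta> s q = ln (4 * A s) - 2 * ln (1 - q)" for s q
  define b where "b s y = \<beta> s (y \<bullet> y) + ln (P s (y \<bullet> y) - \<epsilon>) / p" for s and y :: "real ^ 'm"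
  \<comment> \<open>Without a logarithm of the front, \<open>\<theta>\<close> is continuous on the
    whole closed ball. Where the front is at most 0, \<open>\<theta>\<close> is negative by itself,
    so contact occurs only where \<open>b\<close> is meaningful.\<close>
  define \<theta> where "\<theta> s y = P s (y \<bullet> y) - \<epsilon> - exp (p * (f s y - \<beta> s (y \<bullet> y)))" for s y
  have \<theta>_le: "b s y \<le> f s y" if "\<theta> s y \<le> 0" "\<epsilon> < P s (y \<bullet> y)" for s y
  proof -
    have "ln (P s (y \<bullet> y) - \<epsilon>) \<le> ln (exp (p * (f s y - \<beta> s (y \<bullet> y))))"
      using that by (intro ln_mono) (auto simp: \<theta>_def)
    then have "ln (P s (y \<bullet> y) - \<epsilon>) / p \<le> f s y - \<beta> s (y \<bullet> y)"
      using p by (simp add: pos_divide_le_eq mult.commute)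
    then show ?thesis by (simp add: b_def)
  qed
  have \<theta>_eq: "b s y = f s y \<and> \<epsilon> < P s (y \<bullet> y)" if "\<theta> s y = 0" for s y
  proof -
    have "P s (y \<bullet> y) - \<epsilon> = exp (p * (f s y - \<beta> s (y \<bullet> y)))"
      using that by (simp add: \<theta>_def)
    moreover from this have "\<epsilon> < P s (y \<bullet> y)"
      using exp_gt_zero[of "p * (f s y - \<beta> s (y \<bullet> y))"] by linarith
    ultimately show ?thesis using p by (simp add: b_def)
  qed
  have z_pos: "\<epsilon> * exp (C * s) / (1 - q) > 0" if "q < 1" for s q
    using \<epsilon> that by simp
  have P_less: "P s q < 1" if "q < 1" for s q
    using z_pos[OF that, of s] k by (simp add: P_def)
  \<comment> \<open>Chosen such that \<open>F \<le> 0\<close> for \<open>|x|\<^sup>2 = q0\<close>: no contact on the boundary of the ball of radius \<open>\<surd>q0\<close>.\<close>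
  define q0 where "q0 = max (x \<bullet> x) (1 - \<epsilon>\<^sup>2)"
  have x1: "x \<bullet> x < 1" using ball_D[OF x] by simp
  have q0: "x \<bullet> x \<le> q0" "q0 < 1" "0 \<le> q0" using x1 \<epsilon> by (auto simp: q0_def le_max_iff_disj)
  have inner_le: "y \<bullet> y \<le> q0 \<longleftrightarrow> y \<in> cball 0 (sqrt q0)" for y :: "real ^ 'm"
    by (simp add: norm_eq_sqrt_inner)
  have inner_less: "y \<bullet> y < q0 \<longleftrightarrow> y \<in> ball 0 (sqrt q0)" for y :: "real ^ 'm"
    by (simp add: norm_eq_sqrt_inner)
  \<comment> \<open>From \<open>1 - q0 \<le> \<epsilon>\<^sup>2\<close> the front variable is at
    least \<open>1 / \<epsilon>\<close>, and since \<open>k \<ge> 1\<close> the power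
    \<open>P\<close> is then at most \<open>\<epsilon>\<close>.\<close>
  have P_boundary: "P s q0 \<le> \<epsilon>" if "0 \<le> s" for s
  proof -
    have "1 - q0 \<le> \<epsilon>\<^sup>2" by (simp add: q0_def)
    then have "\<epsilon> / \<epsilon>\<^sup>2 \<le> \<epsilon> / (1 - q0)"
      using \<epsilon> q0 by (intro divide_left_mono) auto
    also have "\<dots> \<le> \<epsilon> * exp (C * s) / (1 - q0)"
      using \<epsilon> q0 C that by (intro divide_right_mono) auto
    finally have z: "1 / \<epsilon> \<le> \<epsilon> * exp (C * s) / (1 - q0)"
      using \<epsilon> by (simp add: power2_eq_square)
    then have "ln (1 / \<epsilon>) \<le> ln (1 + \<epsilon> * exp (C * s) / (1 - q0))"
      using \<epsilon> q0 by (intro ln_mono) (auto intro: add_pos_pos)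
    also have "\<dots> \<le> k * ln (1 + \<epsilon> * exp (C * s) / (1 - q0))"
      using k z_pos[OF q0(2), of s] by (simp add: mult_le_cancel_right1)
    finally have "- k * ln (1 + \<epsilon> * exp (C * s) / (1 - q0)) \<le> ln \<epsilon>"
      using \<epsilon> by (simp add: ln_div)
    then show ?thesis unfolding P_def using \<epsilon> by (simp add: ln_ge_iff)
  qed
  have sub: "cball 0 (sqrt q0) \<subseteq> (hyperbolic_space :: (real ^ 'm) set)"
    using q0 by (simp add: cball_subset_ball_iff)
  have "\<theta> t x < 0"
  proof (rule first_contact[where K = "cball 0 (sqrt q0)" and \<tau> = t and \<theta> = \<theta>])
    have "continuous_on ({0..t} \<times> cball 0 (sqrt q0)) (\<lambda>z::real \<times> (real ^ 'm). P (fst z) (snd z \<bullet> snd z))"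
      unfolding P_def
    proof (intro continuous_intros ballI)
      fix z :: "real \<times> (real ^ 'm)" assume "z \<in> {0..t} \<times> cball 0 (sqrt q0)"
      then have z: "snd z \<bullet> snd z < 1" using inner_le[of "snd z"] q0 by (auto simp: mem_Times_iff)
      show "1 - snd z \<bullet> snd z \<noteq> 0" using z by simp
      show "1 + \<epsilon> * exp (C * fst z) / (1 - snd z \<bullet> snd z) \<noteq> 0" using z_pos[OF z, of "fst z"] by linarith
    qed
    moreover have "continuous_on ({0..t} \<times> cball 0 (sqrt q0)) (\<lambda>z::real \<times> (real ^ 'm). \<beta> (fst z) (snd z \<bullet> snd z))"
      unfolding \<beta>_def A_def[abs_def]
    proof (intro continuous_intros ballI)
      fix z :: "real \<times> (real ^ 'm)" assume zz: "z \<in> {0..t} \<times> cball 0 (sqrt q0)"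
      then have z: "snd z \<bullet> snd z < 1" using inner_le[of "snd z"] q0 by (auto simp: mem_Times_iff)
      show "1 - snd z \<bullet> snd z \<noteq> 0" using z by simp
      show "4 * (1 + m * (m - 1) * fst z) \<noteq> 0" using A[of "fst z"] zz by (auto simp: A_def mem_Times_iff)
    qed
    ultimately show "continuous_on ({0..t} \<times> cball 0 (sqrt q0)) (\<lambda>(t, x). \<theta> t x)"
      unfolding \<theta>_def case_prod_beta
      by (intro continuous_intros continuous_on_subcylinder[OF t sub])
    show "\<theta> 0 y < 0" if "y \<in> cball 0 (sqrt q0)" for y
    proof -
      have "y \<bullet> y < 1" using inner_le[of y] that q0 by simp
      then have "P 0 (y \<bullet> y) < 1" by (rule P_less)
      moreover have "f 0 y = \<beta> 0 (y \<bullet> y)" using init[of y] that sub by (auto simp: \<beta>_def A_def)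
      ultimately show ?thesis using \<epsilon> by (simp add: \<theta>_def)
    qed
    show False if s: "0 < s" "s \<le> t" and y: "y \<in> cball 0 (sqrt q0)" and eq: "\<theta> s y = 0"
      and le: "\<And>u z. 0 \<le> u \<Longrightarrow> u \<le> s \<Longrightarrow> z \<in> cball 0 (sqrt q0) \<Longrightarrow> \<theta> u z \<le> 0" for s y
    proof -
      \<comment> \<open>The part of the ball where the front is positive at time \<open>s\<close>,
        that is, where \<open>b s\<close> is smooth.\<close>
      define M where "M = ball 0 (sqrt q0) \<inter> {z :: real ^ 'm. z \<in> ball 0 1 \<and> \<epsilon> < P s (z \<bullet> z)}"
      have M_D: "z \<bullet> z < 1" "z \<in> ball 0 (sqrt q0)" "\<epsilon> < P s (z \<bullet> z)" if "z \<in> M" for z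
        using that inner_less[of z] q0 by (auto simp: M_def)
      have "open M"
      proof -
        have c: "continuous_on (ball 0 1 :: (real ^ 'm) set) (\<lambda>z. P s (z \<bullet> z))"
          unfolding P_def
        proof (intro continuous_intros ballI)
          fix z :: "real ^ 'm" assume "z \<in> ball 0 1"
          then have z: "z \<bullet> z < 1" using ball_D[of z] by simp
          show "1 - z \<bullet> z \<noteq> 0" using z by simp
          show "1 + \<epsilon> * exp (C * s) / (1 - z \<bullet> z) \<noteq> 0" using z_pos[OF z, of s] by linarith
        qed
        have "{z :: real ^ 'm. z \<in> ball 0 1 \<and> \<epsilon> < P s (z \<bullet> z)} = (\<lambda>z. P s (z \<bullet> z)) -` {\<epsilon><..} \<inter> ball 0 1"
          by auto
        moreover have "open ((\<lambda>z. P s (z \<bullet> z)) -` {\<epsilon><..} \<inter> (ball 0 1 :: (real ^ 'm) set))"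
          using iffD1[OF continuous_on_open_vimage[OF open_ball] c] open_greaterThan by blast
        ultimately show ?thesis unfolding M_def by (metis open_Int open_ball)
      qed
      have yP: "\<epsilon> < P s (y \<bullet> y)" and yb: "b s y = f s y" using \<theta>_eq[OF eq] by auto
      have "y \<bullet> y \<noteq> q0" using yP P_boundary[of s] s by auto
      then have yq: "y \<bullet> y < q0" using y inner_le[of y] by simp
      have yM: "y \<in> M" using yP yq inner_less[of y] subsetD[OF sub y] by (simp add: M_def)
      have y1: "y \<bullet> y < 1" using yq q0 by simp
      define z where "z q = \<epsilon> * exp (C * s) / (1 - q)" for q
      define F where "F q = P s q - \<epsilon>" for q
      \<comment> \<open>\<open>F'\<close> and \<open>F''\<close> are the derivatives of the front in
        the squared norm \<open>q\<close>; they rest on \<open>z\<close> having derivative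
        \<open>z / (1 - q)\<close>.\<close>
      define F' where "F' q = - k * P s q * z q / (1 + z q) / (1 - q)" for q
      define F'' where "F'' q = (k * (k + 1) * P s q * (z q)\<^sup>2 / (1 + z q)\<^sup>2
          - 2 * k * P s q * z q / (1 + z q)) / (1 - q)\<^sup>2" for q
      have dz: "(z has_real_derivative z q / (1 - q)) (at q)" if "q < 1" for q
        unfolding z_def[abs_def] using that
        by (auto intro!: derivative_eq_intros simp: power2_eq_square)
      have P_alt: "P s = (\<lambda>q. exp (- k * ln (1 + z q)))" by (simp add: P_def z_def fun_eq_iff)
      have dP: "(P s has_real_derivative F' q) (at q)" if "q < 1" for q
        unfolding P_alt F'_def using z_pos[OF that, of s] dz[OF that] that
        by (auto intro!: derivative_eq_intros simp: z_def[of q, symmetric])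
      have dF: "(F has_real_derivative F' q) (at q)" if "q < 1" for q
        unfolding F_def using dP[OF that] by (auto intro!: derivative_eq_intros)
      have dF': "(F' has_real_derivative F'' q) (at q)" if "q < 1" for q
      proof -
        have zp: "z q > 0" "1 + z q > 0" using z_pos[OF that, of s] by (simp_all add: z_def)
        \<comment> \<open>The left side is the raw output of the product and quotient rules for
          \<open>F'\<close>, with \<open>r\<close> in place of \<open>1 - q\<close>.\<close>
        have alg: "((((- k * (- k * P * z / (1 + z) / r)) * z + z / r * (- k * P)) * (1 + z)
            - (- k * P * z) * (0 + z / r)) / ((1 + z) * (1 + z)) * r
            - (- k * P * z) / (1 + z) * (0 - 1)) / (r * r)
          = (k * (k + 1) * P * z\<^sup>2 / (1 + z)\<^sup>2 - 2 * k * P * z / (1 + z)) / r\<^sup>2"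
          if "r > 0" "z > 0" "1 + z > 0" for P z r :: real
          using that by (simp add: divide_simps power2_eq_square) (simp add: algebra_simps)
        have "((\<lambda>q. - k * P s q * z q / (1 + z q) / (1 - q)) has_real_derivative F'' q) (at q)"
          by (rule DERIV_cong[OF DERIV_divide[OF DERIV_divide[OF DERIV_mult[OF DERIV_cmult[OF dP[OF that]]
                dz[OF that]] DERIV_add[OF DERIV_const dz[OF that]]] DERIV_diff[OF DERIV_const DERIV_ident]]];
              (unfold F'_def F''_def, rule alg)?; insert zp that; simp)
        then show ?thesis unfolding F'_def[abs_def] .
      qed
      define \<phi>' where "\<phi>' q = 2 / (1 - q) + F' q / F q / p" for q
      define \<phi>'' where "\<phi>'' q = 2 / (1 - q)\<^sup>2 + (F'' q * F q - F' q * F' q) / (F q * F q) / p" for q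
      have F_pos: "F (w \<bullet> w) > 0" if "w \<in> M" for w using M_D[OF that] by (simp add: F_def)
      have d1: "((\<lambda>q. \<beta> s q + ln (F q) / p) has_real_derivative \<phi>' (w \<bullet> w)) (at (w \<bullet> w))"
        if "w \<in> M" for w
        unfolding \<beta>_def \<phi>'_def using M_D[OF that] F_pos[OF that] p dF[of "w \<bullet> w"]
        by (auto intro!: derivative_eq_intros)
      have d2: "(\<phi>' has_real_derivative \<phi>'' (w \<bullet> w)) (at (w \<bullet> w))" if "w \<in> M" for w
        unfolding \<phi>'_def[abs_def] \<phi>''_def using M_D[OF that] F_pos[OF that] p dF[of "w \<bullet> w"] dF'[of "w \<bullet> w"]
        by (auto intro!: derivative_eq_intros simp: power2_eq_square)
          (simp add: field_simps)
      have b_alt: "b s = (\<lambda>w. \<beta> s (w \<bullet> w) + ln (F (w \<bullet> w)) / p)" by (simp add: b_def F_def fun_eq_iff)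
      show False
      proof (rule no_contact_from_below[where t = s and x = y and b = b and M = M])
        show "s \<in> time_interval T" using Icc_subset[OF t] s by auto
        show "0 < s" "open M" "y \<in> M" by fact+
        show "M \<subseteq> hyperbolic_space" by (auto simp: M_def)
        show "b s y = f s y" by fact
        show "b s w \<le> f s w" if "w \<in> M" for w
          using \<theta>_le[OF le[of s w]] M_D[OF that] s by auto
        \<comment> \<open>The ordering of \<open>b\<close> and \<open>f\<close> needs a positive
          front; by continuity in time it is still positive shortly before \<open>s\<close>.\<close>
        show "eventually (\<lambda>u. b u y \<le> f u y) (at_left s)"
        proof -
          have "((\<lambda>u. P u (y \<bullet> y)) \<longlongrightarrow> P s (y \<bullet> y)) (at_left s)"
            unfolding P_def using z_pos[OF y1, of s] y1 by (intro tendsto_intros) auto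
          then have "eventually (\<lambda>u. \<epsilon> < P u (y \<bullet> y)) (at_left s)"
            using yP by (rule order_tendstoD(1))
          then show ?thesis
            using eventually_at_left_real[OF s(1)]
            by eventually_elim (use \<theta>_le le y in auto)
        qed
        show "twice_partial_differentiable_on M (b s)"
          unfolding b_alt by (rule radial_conformal_laplacian(1)[OF \<open>open M\<close> d1 d2])
        let ?q = "y \<bullet> y"
        define Y where "Y = 1 / (1 - ?q)"
        have Y: "Y \<ge> 1" using y1 by (simp add: Y_def)
        have zY: "z ?q = \<epsilon> * exp (C * s) * Y" by (simp add: z_def Y_def)
        have zp: "z ?q > 0" using z_pos[OF y1, of s] by (simp add: z_def)
        let ?B = "m * (m - 1) / A s - k * P s ?q * z ?q * C / (1 + z ?q) / (p * F ?q)"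
        show "((\<lambda>u. b u y) has_real_derivative ?B) (at s within {0..s})"
        proof -
          have dA: "(A has_real_derivative m * (m - 1)) (at s within {0..s})"
            unfolding A_def[abs_def] by (auto intro!: derivative_eq_intros)
          have dPt: "((\<lambda>u. P u ?q) has_real_derivative - k * P s ?q * z ?q * C / (1 + z ?q)) (at s within {0..s})"
            unfolding P_def z_def using z_pos[OF y1, of s] y1
            by (auto intro!: derivative_eq_intros simp: mult_ac)
          have "((\<lambda>u. b u y) has_real_derivative
              4 * (m * (m - 1)) / (4 * A s) + (- k * P s ?q * z ?q * C / (1 + z ?q)) / F ?q / p)
            (at s within {0..s})"
            unfolding b_def \<beta>_def F_def using A[of s] s F_pos[OF yM] p dA dPt
            by (auto intro!: derivative_eq_intros simp: F_def mult_ac)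
          moreover have "4 * (m * (m - 1)) / (4 * A s) = m * (m - 1) / A s" by simp
          ultimately show ?thesis by (simp only:) (simp add: mult_ac)
        qed
        have Fp: "F ?q > 0" "F ?q < 1" using F_pos[OF yM] P_less[OF y1, of s] \<epsilon> by (auto simp: F_def)
        define G where "G = exp (ln (F ?q) / p)"
        have G: "0 < G" "G < 1" using Fp p by (auto simp: G_def divide_neg_pos)
        \<comment> \<open>For \<open>z \<le> 1\<close>, \<open>P\<close> is at least
          \<open>2\<close> to the power \<open>- k\<close>, while \<open>\<epsilon>\<close> is at
          most half of that. So \<open>F\<close> is bounded below by
          \<open>exp (- (k + 1) * ln 2)\<close>, independently of \<open>\<epsilon>\<close>; its
          power \<open>1 / p\<close> is the constant in the hypothesis on \<open>C\<close>.\<close>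
        have CG: "m * (m - 1) \<le> C * G" if "z ?q \<le> 1"
        proof -
          have "exp (- k * ln 2) \<le> P s ?q"
            unfolding P_alt using that zp k by (auto intro!: mult_left_mono)
          moreover have "exp (- k * ln 2) = 2 * exp (- (k + 1) * ln 2)"
            by (simp add: algebra_simps exp_diff exp_minus inverse_eq_divide)
          ultimately have "exp (- (k + 1) * ln 2) \<le> F ?q"
            using \<epsilon> unfolding F_def by linarith
          then have "- (k + 1) * ln 2 \<le> ln (F ?q)"
            using Fp by (simp add: ln_ge_iff)
          then have "exp (- (k + 1) * ln 2 / p) \<le> G"
            unfolding G_def using p by (simp add: divide_right_mono)
          then have "C * exp (- (k + 1) * ln 2 / p) \<le> C * G"
            using C by (intro mult_left_mono)
          then show ?thesis using C by linarith
        qed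
        have \<delta>: "0 < \<epsilon> * exp (C * s)" "\<epsilon> * exp (C * s) \<le> 1 / 2"
        proof -
          have "\<epsilon> * exp (C * s) \<le> \<epsilon> * exp (C * t)"
            using \<epsilon> C s by (intro mult_left_mono) (auto intro: mult_left_mono)
          then show "\<epsilon> * exp (C * s) \<le> 1 / 2" using \<epsilon> by linarith
        qed (use \<epsilon> in simp)
        have exp_b: "exp (- b s y) = 1 / (4 * A s * Y\<^sup>2 * G)"
        proof -
          have "exp (b s y) = 4 * A s * Y\<^sup>2 * G"
            using A[of s] s y1
            by (simp add: b_alt \<beta>_def exp_add exp_diff exp_double G_def[symmetric] Y_def power_divide)
          then show ?thesis by (simp add: exp_minus inverse_eq_divide)
        qed
        have lap: "conformal_laplacian (b s) y = 4 * m * Y\<^sup>2 +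
          (4 * k * (k + 1) * P s ?q * (z ?q)\<^sup>2 * (Y\<^sup>2 - Y) / (1 + z ?q)\<^sup>2
            - k * P s ?q * z ?q * Y * (4 * m * Y - 2 * m) / (1 + z ?q)) / (p * F ?q)"
        proof -
          define D where "D = F' ?q / F ?q"
          define E where "E = F'' ?q / F ?q"
          have qY: "?q = 1 - 1 / Y" using y1 by (simp add: Y_def)
          have "conformal_laplacian (b s) y = 4 * ?q * (\<phi>'' ?q + (m - 2) / 4 * (\<phi>' ?q)\<^sup>2) + 2 * m * \<phi>' ?q"
            unfolding b_alt m_def by (rule radial_conformal_laplacian(2)[OF \<open>open M\<close> d1 d2 yM])
          also have "\<phi>' ?q = 2 * Y + D / p" by (simp add: \<phi>'_def Y_def D_def)
          also have "\<phi>'' ?q = 2 * Y\<^sup>2 + (E - D\<^sup>2) / p"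
            unfolding \<phi>''_def Y_def D_def E_def using Fp by (simp add: field_simps power2_eq_square)
          also have "(m - 2) / 4 = p" by (simp add: p_def)
          \<comment> \<open>The squares of \<open>D\<close> cancel, because
            \<open>p * (D / p)\<^sup>2 = D\<^sup>2 / p\<close>: with the exponent
            \<open>1 / p\<close>, the derivatives of the front enter linearly.\<close>
          also have "4 * ?q * (2 * Y\<^sup>2 + (E - D\<^sup>2) / p + p * (2 * Y + D / p)\<^sup>2) + 2 * m * (2 * Y + D / p)
            = 4 * ?q * ((2 + 4 * p) * Y\<^sup>2 + E / p + 4 * Y * D) + 2 * m * (2 * Y + D / p)"
            using p by (simp add: field_simps power2_eq_square)
          also have "2 + 4 * p = m" by (simp add: p_def field_simps)
          also have "4 * ?q * (m * Y\<^sup>2 + E / p + 4 * Y * D) + 2 * m * (2 * Y + D / p)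
            = 4 * m * Y\<^sup>2 + (4 * ?q * E + (16 * p * ?q * Y + 2 * m) * D) / p"
            unfolding qY using p Y by (simp add: field_simps power2_eq_square)
          also have "4 * ?q * E + (16 * p * ?q * Y + 2 * m) * D =
             (4 * k * (k + 1) * P s ?q * (z ?q)\<^sup>2 * (Y\<^sup>2 - Y) / (1 + z ?q)\<^sup>2
            - k * P s ?q * z ?q * Y * (4 * m * Y - 2 * m) / (1 + z ?q)) / F ?q"
          proof -
            have D: "D = - (k * P s ?q * z ?q / (1 + z ?q)) * Y / F ?q"
              by (simp add: D_def F'_def Y_def)
            have E: "E = (k * (k + 1) * P s ?q * (z ?q)\<^sup>2 / (1 + z ?q)\<^sup>2
                - 2 * (k * P s ?q * z ?q / (1 + z ?q))) * Y\<^sup>2 / F ?q"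
              by (simp add: E_def F''_def Y_def power_divide)
            have p4: "16 * p = 4 * (m - 2)" by (simp add: p_def)
            define U where "U = k * (k + 1) * P s ?q * (z ?q)\<^sup>2 / (1 + z ?q)\<^sup>2"
            define V where "V = k * P s ?q * z ?q / (1 + z ?q)"
            have alg: "4 * Q * ((U - 2 * V) * Y\<^sup>2 / R) + (4 * (m - 2) * Q * Y + 2 * m) * (- V * Y / R)
              = (4 * U * (Y\<^sup>2 - Y) - V * Y * (4 * m * Y - 2 * m)) / R"
              if "R > 0" "Q = 1 - 1 / Y" for Q R
              unfolding that(2) using that(1) Y by (simp add: field_simps power2_eq_square)
            have "4 * ?q * E + (16 * p * ?q * Y + 2 * m) * D
              = (4 * U * (Y\<^sup>2 - Y) - V * Y * (4 * m * Y - 2 * m)) / F ?q"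
              unfolding D E p4 U_def[symmetric] V_def[symmetric] by (rule alg[OF Fp(1) qY])
            then show ?thesis by (simp add: U_def V_def mult_ac)
          qed
          finally show ?thesis by (simp add: mult_ac)
        qed
        show "?B < (real CARD('m) - 1) * exp (- b s y) * conformal_laplacian (b s) y"
          unfolding exp_b lap m_def[symmetric]
          by (rule subsolution_inequality[OF m p_def[THEN meta_eq_to_obj_eq] k(2) Y Fp(1) G _ _ zY \<delta> C(1) CG])
             (use A[of s] s in \<open>auto simp: P_def\<close>)
      qed
    qed
  qed (use t x q0 inner_le[of x] in \<open>auto simp: time_interval_def\<close>)
  then show ?thesis by (simp add: \<theta>_def P_def \<beta>_def A_def)
qed

lemma lower_bound:
  assumes t: "t \<in> time_interval T" and x: "x \<in> hyperbolic_space"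
  shows "4 * (real CARD('m) * (real CARD('m) - 1) * t + 1) \<le> exp (f t x) * (1 - x \<bullet> x)\<^sup>2"
proof -
  define m where "m = real CARD('m)"
  define k where "k = 4 * m - 1"
  define p where "p = (m - 2) / 4"
  have m: "m \<ge> 3" using dim by (simp add: m_def)
  have p: "p > 0" using m by (simp add: p_def)
  \<comment> \<open>The least speed that \<open>lower_barrier\<close> admits. It does not depend on
    \<open>\<epsilon>\<close>, so \<open>\<epsilon> * exp (C * t)\<close> tends to 0 with
    \<open>\<epsilon>\<close>.\<close>
  define C where "C = m * (m - 1) / exp (- (k + 1) * ln 2 / p)"
  have C: "0 \<le> C" "m * (m - 1) \<le> C * exp (- (k + 1) * ln 2 / p)" using m by (auto simp: C_def)
  have x1: "x \<bullet> x < 1" using ball_D[OF x] by simp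
  have t0: "0 \<le> t" using t by (simp add: time_interval_def)
  let ?v = "ln (4 * (1 + m * (m - 1) * t)) - 2 * ln (1 - x \<bullet> x)"
  define \<epsilon>0 where "\<epsilon>0 = min (1 / 2 / exp (C * t)) (exp (- (k + 1) * ln 2))"
  have "\<epsilon>0 > 0" by (simp add: \<epsilon>0_def)
  \<comment> \<open>At fixed \<open>t\<close> and \<open>x\<close> the front tends to 1, so in the
    limit the ratio of the flow to the expected solution is at least 1.\<close>
  have "((\<lambda>\<epsilon>. exp (- k * ln (1 + \<epsilon> * exp (C * t) / (1 - x \<bullet> x))) - \<epsilon>) \<longlongrightarrow>
      exp (- k * ln (1 + 0 * exp (C * t) / (1 - x \<bullet> x))) - 0) (at_right 0)"
    using x1 by (intro tendsto_intros) auto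
  moreover have "eventually (\<lambda>\<epsilon>. exp (- k * ln (1 + \<epsilon> * exp (C * t) / (1 - x \<bullet> x))) - \<epsilon>
      \<le> exp (p * (f t x - ?v))) (at_right 0)"
  proof (rule eventually_mono[OF eventually_at_right_real[OF \<open>\<epsilon>0 > 0\<close>]])
    fix \<epsilon> assume "\<epsilon> \<in> {0<..<\<epsilon>0}"
    then show "exp (- k * ln (1 + \<epsilon> * exp (C * t) / (1 - x \<bullet> x))) - \<epsilon> \<le> exp (p * (f t x - ?v))"
      using lower_barrier[of C t x \<epsilon>] C t x unfolding m_def[symmetric] k_def[symmetric] p_def[symmetric]
      by (auto simp: \<epsilon>0_def pos_less_divide_eq)
  qed
  ultimately have "exp (- k * ln (1 + 0 * exp (C * t) / (1 - x \<bullet> x))) - 0 \<le> exp (p * (f t x - ?v))"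
    by (rule tendsto_upperbound) simp
  then have "?v \<le> f t x" using p by (simp add: zero_le_mult_iff)
  then have "exp ?v \<le> exp (f t x)" by simp
  moreover have "exp ?v * (1 - x \<bullet> x)\<^sup>2 = 4 * (1 + m * (m - 1) * t)"
  proof -
    have "0 \<le> m * (m - 1) * t" using m t0 by simp
    then show ?thesis using x1 by (simp add: exp_diff exp_double)
  qed
  ultimately have "4 * (1 + m * (m - 1) * t) \<le> exp (f t x) * (1 - x \<bullet> x)\<^sup>2"
    by (metis mult_right_mono zero_le_power2)
  then show ?thesis by (simp add: m_def algebra_simps)
qed

end

section \<open>Reduction of the flow to a scalar function, and conclusion\<close>

lemma twice_partial_differentiable_on_ln:
  fixes w :: "real ^ 'm::finite \<Rightarrow> real"
  assumes M: "open M" and w: "twice_partial_differentiable_on M w" and pos: "\<And>y. y \<in> M \<Longrightarrow> w y > 0"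
  shows "twice_partial_differentiable_on M (\<lambda>y. ln (w y))"
proof -
  have w1: "partial_differentiable i w y" if "y \<in> M" for i y
    using w that by (simp add: twice_partial_differentiable_on_def)
  have w2: "partial_differentiable j (partial_deriv i w) y" if "y \<in> M" for i j y
    using w that by (simp add: twice_partial_differentiable_on_def)
  have p1: "((\<lambda>s. ln (w (y + s *\<^sub>R axis i 1))) has_real_derivative partial_deriv i w y / w y) (at 0)"
    if "y \<in> M" for i y
    using pos[OF that] partial_differentiableD[OF w1[OF that]]
    by (auto intro!: derivative_eq_intros)
  have p1': "partial_deriv i (\<lambda>y. ln (w y)) y = partial_deriv i w y / w y" if "y \<in> M" for i y
    by (rule partial_deriv_eqI[OF p1[OF that]])
  have "partial_differentiable j (\<lambda>y. partial_deriv i w y / w y) y" if "y \<in> M" for i j y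
    by (rule partial_differentiableI[OF DERIV_divide[OF partial_differentiableD[OF w2[OF that]]
          partial_differentiableD[OF w1[OF that]]]])
       (use pos[OF that] in simp)
  then have p2: "partial_differentiable j (partial_deriv i (\<lambda>y. ln (w y))) y" if "y \<in> M" for i j y
    using partial_differentiable_cong[OF M that p1'] that by simp
  show ?thesis
    using p2 partial_differentiableI[OF p1] by (auto simp: twice_partial_differentiable_on_def)
qed

theorem theorem2:
  fixes T :: ereal and g :: "real \<Rightarrow> real ^ 'm::finite \<Rightarrow> real ^ 'm ^ 'm"
  assumes "3 \<le> CARD('m)"
    and "0 < T"
    and "yamabe_flow_on hyperbolic_space T g"
    and "\<forall>x\<in>hyperbolic_space. g 0 x = hyperbolic_metric x"
  shows "\<forall>t\<in>time_interval T. \<forall>x\<in>hyperbolic_space.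
           g t x = (real CARD('m) * (real CARD('m) - 1) * t + 1) *\<^sub>R hyperbolic_metric x"
proof -
  let ?I = "time_interval T" and ?B = "hyperbolic_space :: (real ^ 'm) set"
  have I0: "0 \<in> ?I" using assms(2) by (simp add: time_interval_def zero_ereal_def)
  have "convex ?I"
    by (rule is_interval_convex, unfold is_interval_1)
       (auto simp: time_interval_def intro: order.strict_trans1[of "ereal _" "ereal _"])
  \<comment> \<open>Any index will do: a diagonal entry of a positive definite matrix is positive
    and can serve as the conformal factor.\<close>
  define k0 :: 'm where "k0 = undefined"
  define w where "w t x = g t x $ k0 $ k0" for t x
  define f where "f t x = ln (w t x)" for t x
  have pos: "w t x > 0" if "t \<in> ?I" "x \<in> ?B" for t x
  proof -
    have "0 < v \<bullet> (g t x *v v)" if "v \<noteq> 0" for v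
      using assms(3) \<open>t \<in> ?I\<close> \<open>x \<in> ?B\<close> that unfolding yamabe_flow_on_def riemannian_metric_on_def by blast
    from this[of "axis k0 1"] show ?thesis
      by (simp add: w_def matrix_vector_mult_basis inner_axis' column_def axis_eq_0_iff)
  qed
  have flow: "((\<lambda>s. g s x $ i $ j) has_real_derivative - scalar_curvature (g t) x * g t x $ i $ j) (at t within ?I)"
    if "t \<in> ?I" "x \<in> ?B" for t x i j
  proof -
    have "((\<lambda>s. g s x) has_vector_derivative - scalar_curvature (g t) x *\<^sub>R g t x) (at t within ?I)"
      using assms(3) that unfolding yamabe_flow_on_def by blast
    then have "((\<lambda>s. g s x $ i $ j) has_vector_derivative (- scalar_curvature (g t) x *\<^sub>R g t x) $ i $ j) (at t within ?I)"
      by (intro bounded_linear.has_vector_derivative[OF bounded_linear_vec_nth])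
    then show ?thesis by (simp add: has_real_derivative_iff_has_vector_derivative)
  qed
  have wflow: "((\<lambda>s. w s x) has_real_derivative - scalar_curvature (g t) x * w t x) (at t within ?I)"
    if "t \<in> ?I" "x \<in> ?B" for t x
    using flow[OF that] by (simp add: w_def)
  have g0: "g 0 x = (4 / (1 - x \<bullet> x)\<^sup>2) *\<^sub>R mat 1" if "x \<in> ?B" for x
    using assms(4) that hyperbolic_metric_alt[of 1 x] by simp
  have w0: "w 0 x = 4 / (1 - x \<bullet> x)\<^sup>2" if "x \<in> ?B" for x
    unfolding w_def g0[OF that] conformal_component by simp
  \<comment> \<open>At fixed \<open>x\<close> every entry satisfies \<open>u' = - R u\<close> with
    the same scalar curvature \<open>R\<close>, so its quotient by \<open>w\<close> is constant in
    time and keeps its initial value \<open>kron i j\<close>.\<close>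
  have comp: "g t x $ i $ j = w t x * kron i j" if t: "t \<in> ?I" and x: "x \<in> ?B" for t x i j
  proof -
    have "((\<lambda>s. g s x $ i $ j / w s x) has_field_derivative 0) (at s within ?I)" if "s \<in> ?I" for s
      using DERIV_divide[OF flow[OF that x, of i j] wflow[OF that x]] pos[OF that x] by simp
    then obtain c where c: "\<And>s. s \<in> ?I \<Longrightarrow> g s x $ i $ j / w s x = c"
      using has_field_derivative_zero_constant[OF \<open>convex ?I\<close>, of "\<lambda>s. g s x $ i $ j / w s x"] by blast
    have "g t x $ i $ j / w t x = g 0 x $ i $ j / w 0 x" using c[OF t] c[OF I0] by simp
    also have "\<dots> = kron i j"
      using pos[OF I0 x] unfolding w0[OF x] unfolding g0[OF x] conformal_component by simp
    finally show ?thesis using pos[OF t x] by (simp add: field_simps)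
  qed
  have conf: "g t x = exp (f t x) *\<^sub>R mat 1" if "t \<in> ?I" "x \<in> ?B" for t x
    unfolding vec_eq_iff conformal_component using pos[OF that] comp[OF that] by (simp add: f_def)
  have C21: "C21_on ?B ?I w"
    using assms(3) unfolding yamabe_flow_on_def w_def[abs_def] by blast
  have space: "twice_partial_differentiable_on ?B (f t)" if "t \<in> ?I" for t
  proof -
    have "twice_partial_differentiable_on ?B (w t)"
      using C21 that unfolding C21_on_def twice_partial_differentiable_on_def by blast
    then show ?thesis
      unfolding f_def[abs_def] by (rule twice_partial_differentiable_on_ln[OF open_ball _ pos[OF that]])
  qed
  interpret conformal_yamabe_flow T f
  proof
    show "3 \<le> CARD('m)" by fact
    have "continuous_on (?I \<times> ?B) (\<lambda>(t, x). w t x)" using C21 by (simp add: C21_on_def)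
    then show "continuous_on (?I \<times> ?B) (\<lambda>(t, x). f t x)"
      unfolding f_def case_prod_beta
      by (intro continuous_on_ln ballI) (use pos in \<open>force simp: mem_Times_iff\<close>)+
    show "twice_partial_differentiable_on ?B (f t)" if "t \<in> ?I" for t by (rule space[OF that])
    show "((\<lambda>s. f s x) has_real_derivative
         (real CARD('m) - 1) * exp (- f t x) * conformal_laplacian (f t) x) (at t within ?I)"
      if "t \<in> ?I" "x \<in> ?B" for t x
    proof -
      have "((\<lambda>s. f s x) has_real_derivative - scalar_curvature (g t) x) (at t within ?I)"
        unfolding f_def using wflow[OF that] pos[OF that]
        by (auto intro!: derivative_eq_intros)
      moreover have "scalar_curvature (g t) x =
          - (real CARD('m) - 1) * exp (- f t x) * conformal_laplacian (f t) x"
        by (rule scalar_curvature_conformally_flat[OF open_ball that(2) conf[OF that(1)] space[OF that(1)]])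
      ultimately show ?thesis by (simp only: mult_minus_left minus_minus)
    qed
    show "f 0 x = ln 4 - 2 * ln (1 - x \<bullet> x)" if "x \<in> ?B" for x
      using ball_D[OF that] by (simp add: f_def w0[OF that] ln_div ln_realpow)
  qed
  show ?thesis
  proof (intro ballI)
    fix t and x :: "real ^ 'm" assume t: "t \<in> ?I" and x: "x \<in> ?B"
    let ?a = "real CARD('m) * (real CARD('m) - 1) * t + 1"
    have "exp (f t x) * (1 - x \<bullet> x)\<^sup>2 = 4 * ?a"
      using upper_bound[OF t x] lower_bound[OF t x] by (rule antisym)
    then have "exp (f t x) = 4 * ?a / (1 - x \<bullet> x)\<^sup>2"
      using ball_D[OF x] by (simp add: eq_divide_eq)
    then show "g t x = ?a *\<^sub>R hyperbolic_metric x"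
      unfolding conf[OF t x] hyperbolic_metric_alt by simp
  qed
qed

end
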